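(* Consider the linear system $\dot{\mathbf{x}} = \mathbf{A}\mathbf{x} + \mathbf{B}\mathbf{u}$ with $\mathbf{A}\in\mathbb{R}^{n\times n}$, $\mathbf{B}\in\mathbb{R}^{n\times m}$, and affine constraint functions $h_i(\mathbf{x}) = \mathbf{c}_i^\top\mathbf{x}+d_i$, $i\in[\bar p]$, where $h_i$ has relative degree $r_i\geq 1$, together with constants $\alpha_{i,j}>0$ ($i\in[\bar p]$, $j\in[r_i]$). Let $\boldsymbol{\ell}_i = \mathbf{B}^\top(\mathbf{A}^{r_i-1})^\top\mathbf{c}_i\in\mathbb{R}^m$, and assume that, for some $p\le\bar p$, $\{\boldsymbol{\ell}_i\}_{i=1}^{p}$ are linearly independent and $\{\boldsymbol{\ell}_i\}_{i=p+1}^{\bar p}$ are linear combinations of $\{\boldsymbol{\ell}_i\}_{i=1}^{p}$. Then there exists $\mathbf{K}\in\mathbb{R}^{m\times n}$ such that $\mathbf{u}=-\mathbf{K}\mathbf{x}$ satisfies all $\bar p$ HOCBF constraints for all $\mathbf{x}\in\mathbb{R}^n$, i.e. $$\mathbf{c}_i^\top\boldsymbol{\Phi}_i(\mathbf{A})\mathbf{x} - \boldsymbol{\ell}_i^\top\mathbf{K}\mathbf{x} + \alpha_i d_i\geq 0\qquad \text{for all } i\in[\bar p],\ \mathbf{x}\in\mathbb{R}^n,$$ and renders the origin $\mathbf{0}_n$ globally exponentially stable for $\dot{\mathbf{x}}=(\mathbf{A}-\mathbf{B}\mathbf{K})\mathbf{x}$, if and only if all of the following hold: 1. $d_i\geq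 0$ for all $i\in[\bar p]$; 2. $\mathbf{c}_i^\top\boldsymbol{\Phi}_i(\mathbf{A})-\boldsymbol{\ell}_i^\top\mathbf{K}_0=\mathbf{0}_n^\top$ for all $i\in[\bar p]\setminus[p]$; 3. the pair $(\boldsymbol{\Gamma}_{\boldsymbol{\eta}},\mathbf{T}_{\boldsymbol{\eta}}^\top\mathbf{B}\mathbf{L}_\perp)$ is stabilizable (or equivalently, the pair $(\mathbf{A}-\mathbf{B}\mathbf{K}_0,\mathbf{B}\mathbf{L}_\perp)$ is stabilizable). In that case, the set of all such matrices is $$\{\mathbf{K}\in\mathbb{R}^{m\times n} : \mathbf{K}=\mathbf{K}_0+\mathbf{L}_\perp\tilde{\mathbf{K}},\ \tilde{\mathbf{K}}\in\mathbb{R}^{(m-p)\times n},\ \mathbf{A}-\mathbf{B}\mathbf{K}\text{ Hurwitz}\}.$$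
   Context: $[k]=\{1,\dots,k\}$. For the linear system, $h_i(\mathbf{x})=\mathbf{c}_i^\top\mathbf{x}+d_i$ (with $\mathbf{c}_i\in\mathbb{R}^n$, $d_i\in\mathbb{R}$) has relative degree $r_i\in\mathbb{Z}_{>0}$ if $\mathbf{c}_i^\top\mathbf{A}^{r_i-1}\mathbf{B}\neq\mathbf{0}$ and $\mathbf{c}_i^\top\mathbf{A}^{k}\mathbf{B}=\mathbf{0}$ for all $0\le k<r_i-1$. Set $\boldsymbol{\Phi}_{i,j}(\mathbf{A})=\prod_{l=1}^{j}(\mathbf{A}+\alpha_{i,l}\mathbf{I}_n)$ (so $\boldsymbol{\Phi}_{i,0}(\mathbf{A})=\mathbf{I}_n$), $\boldsymbol{\Phi}_i=\boldsymbol{\Phi}_{i,r_i}$ and $\alpha_i=\prod_{j=1}^{r_i}\alpha_{i,j}$. The $i$-th HOCBF (high-order control barrier function) constraint on a pair $(\mathbf{x},\mathbf{u})$ is $\mathbf{c}_i^\top\boldsymbol{\Phi}_i(\mathbf{A})\mathbf{x}+\mathbf{c}_i^\top\mathbf{A}^{r_i-1}\mathbf{B}\mathbf{u}+\alpha_i d_i\geq 0$. $\mathbf{L}\in\mathbb{R}^{m\times p}$ is the matrix with columns $\boldsymbol{\ell}_1,\dots,\boldsymbol{\ell}_p$; $\mathbf{L}_\perp\in\mathbb{R}^{m\times(m-p)}$ is a matrix whose columns form a basis of $\ker(\mathbf{L}^\top)$ (empty if $m=p$); $\tilde{\mathbf{C}}\in\mathbb{R}^{p\times n}$ is the matrix whose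 $i$-th row is $\mathbf{c}_i^\top\boldsymbol{\Phi}_i(\mathbf{A})$, $i\in[p]$; $\mathbf{K}_0=\mathbf{L}(\mathbf{L}^\top\mathbf{L})^{-1}\tilde{\mathbf{C}}$. Let $r=\sum_{i=1}^p r_i$. $\mathbf{T}_{\boldsymbol{\psi}}\in\mathbb{R}^{n\times r}$ is the matrix whose columns are the vectors $\boldsymbol{\Phi}_{i,j}(\mathbf{A})^\top\mathbf{c}_i$, $i\in[p]$, $0\le j\le r_i-1$ (these are linearly independent under the stated assumptions, so $r\le n$). $\mathbf{T}_{\boldsymbol{\eta}}\in\mathbb{R}^{n\times(n-r)}$ is a full column rank matrix whose columns span $\ker(\mathbf{T}_{\boldsymbol{\psi}}^\top)$. Define $\hat{\mathbf{A}}=\mathbf{T}_{\boldsymbol{\eta}}^\top\mathbf{A}-\mathbf{T}_{\boldsymbol{\eta}}^\top\mathbf{B}\mathbf{L}(\mathbf{L}^\top\mathbf{L})^{-1}\tilde{\mathbf{C}}$ and $\boldsymbol{\Gamma}_{\boldsymbol{\eta}}=\hat{\mathbf{A}}\mathbf{T}_{\boldsymbol{\eta}}(\mathbf{T}_{\boldsymbol{\eta}}^\top\mathbf{T}_{\boldsymbol{\eta}})^{-1}\in\mathbb{R}^{(n-r)\times(n-r)}$. A square real matrix is Hurwitz if all its eigenvalues have negative real part; a pair $(\mathbf{F},\mathbf{G})$ is stabilizable if there is a matrix $\mathbf{H}$ with $\mathbf{F}-\mathbf{G}\mathbf{H}$ Hurwitz. (If $\mathbf{G}$ has no columns, this means $\mathbf{F}$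 is Hurwitz; a $0\times 0$ matrix counts as Hurwitz.) *)

theory Defs
  imports
    Complex_Main
    "Jordan_Normal_Form.Char_Poly"
    "Jordan_Normal_Form.Gauss_Jordan_Elimination"
    "Jordan_Normal_Form.Matrix_Kernel"
    "Jordan_Normal_Form.DL_Rank"
begin

abbreviation real_span :: "nat \<Rightarrow> real vec set \<Rightarrow> real vec set" where
  "real_span n \<equiv> LinearCombinations.module.span class_ring (module_vec TYPE(real) n)"

abbreviation real_lin_indpt :: "nat \<Rightarrow> real vec set \<Rightarrow> bool" where
  "real_lin_indpt n \<equiv> LinearCombinations.module.lin_indpt class_ring (module_vec TYPE(real) n)"

text \<open>Linear independence of an indexed family: repeated vectors count as dependent.\<close>

definition lin_indpt_family :: "nat \<Rightarrow> (nat \<Rightarrow> real vec) \<Rightarrow> nat set \<Rightarrow> bool" where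
  "lin_indpt_family n v I \<longleftrightarrow> v ` I \<subseteq> carrier_vec n \<and> inj_on v I \<and> real_lin_indpt n (v ` I)"

definition is_basis_mat :: "nat \<Rightarrow> nat \<Rightarrow> real mat \<Rightarrow> real vec set \<Rightarrow> bool" where
  "is_basis_mat n k M W \<longleftrightarrow>
     M \<in> carrier_mat n k \<and> lin_indpt_family n (col M) {0..<k} \<and>
     real_span n (set (cols M)) = W"

text \<open>Only used for square invertible matrices; otherwise the value is unspecified.\<close>

definition inv_mat :: "real mat \<Rightarrow> real mat" where
  "inv_mat M = the (mat_inverse M)"

definition hurwitz :: "real mat \<Rightarrow> bool" where
  "hurwitz M \<longleftrightarrow> square_mat M \<and>
     (\<forall>\<mu>. eigenvalue (map_mat complex_of_real M) \<mu> \<longrightarrow> Re \<mu> < 0)"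

definition stabilizable :: "real mat \<Rightarrow> real mat \<Rightarrow> bool" where
  "stabilizable F G \<longleftrightarrow> (\<exists>H \<in> carrier_mat (dim_col G) (dim_row F). hurwitz (F - G * H))"

definition euclid_norm :: "real vec \<Rightarrow> real" where
  "euclid_norm v = sqrt (v \<bullet> v)"

definition lin_ode_solution :: "real mat \<Rightarrow> (real \<Rightarrow> real vec) \<Rightarrow> bool" where
  "lin_ode_solution M x \<longleftrightarrow>
     (\<forall>t\<ge>0. x t \<in> carrier_vec (dim_row M)) \<and>
     (\<forall>t\<ge>0. \<forall>i < dim_row M.
        ((\<lambda>s. x s $ i) has_real_derivative (M *\<^sub>v x t) $ i) (at t within {0..}))"

text \<open>Solutions of \<open>x' = M x\<close> on \<open>[0, \<infinity>)\<close> exist for every initial value, so quantifying over all of them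
  covers every \<open>x(0)\<close> in \<open>\<real>\<^sup>n\<close>.\<close>

definition globally_exp_stable :: "real mat \<Rightarrow> bool" where
  "globally_exp_stable M \<longleftrightarrow>
     (\<exists>\<kappa>>0. \<exists>\<rho>>0. \<forall>x. lin_ode_solution M x \<longrightarrow>
        (\<forall>t\<ge>0. euclid_norm (x t) \<le> \<kappa> * exp (- \<rho> * t) * euclid_norm (x 0)))"

text \<open>The affine functions are \<open>h\<^sub>i(x) = c\<^sub>i\<^sup>T x + d\<^sub>i\<close>. The indices \<open>i\<close> of \<open>c i\<close>, \<open>d i\<close>, \<open>r i\<close> and
  both indices of \<open>\<alpha> i l\<close> start at 1. A row vector \<open>v\<^sup>T M\<close> is represented by the vector
  \<open>M\<^sup>T v\<close>.\<close>

definition has_relative_degree :: "real mat \<Rightarrow> real mat \<Rightarrow> real vec \<Rightarrow> nat \<Rightarrow> bool" where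
  "has_relative_degree A B v k \<longleftrightarrow> k > 0 \<and>
     transpose_mat (A ^\<^sub>m (k - 1) * B) *\<^sub>v v \<noteq> 0\<^sub>v (dim_col B) \<and>
     (\<forall>j < k - 1. transpose_mat (A ^\<^sub>m j * B) *\<^sub>v v = 0\<^sub>v (dim_col B))"

definition ell :: "real mat \<Rightarrow> real mat \<Rightarrow> (nat \<Rightarrow> real vec) \<Rightarrow> (nat \<Rightarrow> nat) \<Rightarrow> nat \<Rightarrow> real vec" where
  "ell A B c r i = transpose_mat B *\<^sub>v (transpose_mat (A ^\<^sub>m (r i - 1)) *\<^sub>v c i)"

primrec Phi :: "real mat \<Rightarrow> (nat \<Rightarrow> real) \<Rightarrow> nat \<Rightarrow> real mat" where
  "Phi A a 0 = 1\<^sub>m (dim_row A)"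
| "Phi A a (Suc j) = Phi A a j * (A + a (Suc j) \<cdot>\<^sub>m 1\<^sub>m (dim_row A))"

definition cPhi ::
    "real mat \<Rightarrow> (nat \<Rightarrow> real vec) \<Rightarrow> (nat \<Rightarrow> nat) \<Rightarrow> (nat \<Rightarrow> nat \<Rightarrow> real) \<Rightarrow> nat \<Rightarrow> real vec" where
  "cPhi A c r \<alpha> i = transpose_mat (Phi A (\<alpha> i) (r i)) *\<^sub>v c i"

definition hocbf_constraint ::
    "real mat \<Rightarrow> real mat \<Rightarrow> (nat \<Rightarrow> real vec) \<Rightarrow> (nat \<Rightarrow> real) \<Rightarrow> (nat \<Rightarrow> nat) \<Rightarrow>
     (nat \<Rightarrow> nat \<Rightarrow> real) \<Rightarrow> nat \<Rightarrow> real vec \<Rightarrow> real vec \<Rightarrow> bool" where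
  "hocbf_constraint A B c d r \<alpha> i x u \<longleftrightarrow>
     c i \<bullet> (Phi A (\<alpha> i) (r i) *\<^sub>v x) + c i \<bullet> ((A ^\<^sub>m (r i - 1) * B) *\<^sub>v u)
       + (\<Prod>j = 1..r i. \<alpha> i j) * d i \<ge> 0"

definition safe_stabilizing_gain ::
    "real mat \<Rightarrow> real mat \<Rightarrow> (nat \<Rightarrow> real vec) \<Rightarrow> (nat \<Rightarrow> real) \<Rightarrow> (nat \<Rightarrow> nat) \<Rightarrow>
     (nat \<Rightarrow> nat \<Rightarrow> real) \<Rightarrow> nat \<Rightarrow> real mat \<Rightarrow> bool" where
  "safe_stabilizing_gain A B c d r \<alpha> q K \<longleftrightarrow>
     K \<in> carrier_mat (dim_col B) (dim_row A) \<and>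
     (\<forall>i \<in> {1..q}. \<forall>x \<in> carrier_vec (dim_row A).
        hocbf_constraint A B c d r \<alpha> i x (- (K *\<^sub>v x))) \<and>
     globally_exp_stable (A - B * K)"

definition L_mat :: "real mat \<Rightarrow> real mat \<Rightarrow> (nat \<Rightarrow> real vec) \<Rightarrow> (nat \<Rightarrow> nat) \<Rightarrow> nat \<Rightarrow> real mat" where
  "L_mat A B c r p = mat_of_cols (dim_col B) (map (ell A B c r) [1..<Suc p])"

definition C_tilde ::
    "real mat \<Rightarrow> (nat \<Rightarrow> real vec) \<Rightarrow> (nat \<Rightarrow> nat) \<Rightarrow> (nat \<Rightarrow> nat \<Rightarrow> real) \<Rightarrow> nat \<Rightarrow> real mat" where
  "C_tilde A c r \<alpha> p = mat_of_rows (dim_row A) (map (cPhi A c r \<alpha>) [1..<Suc p])"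

definition K_zero ::
    "real mat \<Rightarrow> real mat \<Rightarrow> (nat \<Rightarrow> real vec) \<Rightarrow> (nat \<Rightarrow> nat) \<Rightarrow> (nat \<Rightarrow> nat \<Rightarrow> real) \<Rightarrow> nat \<Rightarrow>
     real mat" where
  "K_zero A B c r \<alpha> p =
     L_mat A B c r p * inv_mat (transpose_mat (L_mat A B c r p) * L_mat A B c r p)
       * C_tilde A c r \<alpha> p"

text \<open>The columns \<open>\<Phi>\<^sub>i\<^sub>,\<^sub>j(A)\<^sup>T c\<^sub>i\<close>, \<open>0 \<le> j < r\<^sub>i\<close>, are ordered lexicographically by \<open>(i, j)\<close>.\<close>

definition T_psi ::
    "real mat \<Rightarrow> (nat \<Rightarrow> real vec) \<Rightarrow> (nat \<Rightarrow> nat) \<Rightarrow> (nat \<Rightarrow> nat \<Rightarrow> real) \<Rightarrow> nat \<Rightarrow> real mat" where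
  "T_psi A c r \<alpha> p = mat_of_cols (dim_row A)
     (concat (map (\<lambda>i. map (\<lambda>j. transpose_mat (Phi A (\<alpha> i) j) *\<^sub>v c i) [0..<r i]) [1..<Suc p]))"

definition A_hat ::
    "real mat \<Rightarrow> real mat \<Rightarrow> (nat \<Rightarrow> real vec) \<Rightarrow> (nat \<Rightarrow> nat) \<Rightarrow> (nat \<Rightarrow> nat \<Rightarrow> real) \<Rightarrow> nat \<Rightarrow>
     real mat \<Rightarrow> real mat" where
  "A_hat A B c r \<alpha> p T\<^sub>\<eta> =
     transpose_mat T\<^sub>\<eta> * A
     - transpose_mat T\<^sub>\<eta> * B * L_mat A B c r p
         * inv_mat (transpose_mat (L_mat A B c r p) * L_mat A B c r p) * C_tilde A c r \<alpha> p"

definition Gamma_eta ::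
    "real mat \<Rightarrow> real mat \<Rightarrow> (nat \<Rightarrow> real vec) \<Rightarrow> (nat \<Rightarrow> nat) \<Rightarrow> (nat \<Rightarrow> nat \<Rightarrow> real) \<Rightarrow> nat \<Rightarrow>
     real mat \<Rightarrow> real mat" where
  "Gamma_eta A B c r \<alpha> p T\<^sub>\<eta> =
     A_hat A B c r \<alpha> p T\<^sub>\<eta> * T\<^sub>\<eta> * inv_mat (transpose_mat T\<^sub>\<eta> * T\<^sub>\<eta>)"

end

theory Submission
  imports Defs "Jordan_Normal_Form.Schur_Decomposition"
begin

text \<open>
  Under \<open>u = - K x\<close> each HOCBF constraint is an affine inequality in \<open>x\<close> with linear part
  \<open>c\<^sub>i\<^sup>T \<Phi>\<^sub>i(A) - \<ell>\<^sub>i\<^sup>T K\<close> and constant part \<open>\<alpha>\<^sub>i d\<^sub>i\<close>. It holds at all states iff the linear part vanishes and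
  \<open>d\<^sub>i \<ge> 0\<close> (\<open>hocbf_constraint_all_states_iff\<close>). For \<open>i \<le> p\<close> the resulting equations are the linear system
  \<open>L\<^sup>T K = C\<close>, with \<open>C\<close> the matrix \<open>C_tilde\<close>, whose solutions are \<open>K\<^sub>0 + L_perp K'\<close>
  (\<open>particular_plus_kernel_solutions\<close>); for \<open>i > p\<close>
  the equation depends only on \<open>L\<^sup>T K\<close>, so all these gains satisfy it or none does. Together with the
  equivalence of exponential stability and the Hurwitz property this describes the set of admissible
  gains, and it is nonempty iff conditions 1 and 2 hold and \<open>(A - B K\<^sub>0, B L_perp)\<close> is stabilizable.

  For the equivalence of the two stabilizability conditions, consider the functionals
  \<open>f\<^sub>i\<^sub>,\<^sub>j = \<Phi>\<^sub>i\<^sub>,\<^sub>j(A)\<^sup>T c\<^sub>i\<close>, the columns of \<open>T\<^sub>\<psi>\<close>. By the relative degree the input acts only on the last one of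
  each chain, and there every gain \<open>K\<^sub>0 + L_perp H\<close> acts in the same way and cancels the next
  term. So in each of these closed loops \<open>N\<close> the chain is a cascade \<open>N\<^sup>T f\<^sub>j = f\<^sub>j\<^sub>+\<^sub>1 - \<alpha>\<^sub>j\<^sub>+\<^sub>1 f\<^sub>j\<close> ending in
  \<open>- \<alpha>\<^sub>r f\<^sub>r\<^sub>-\<^sub>1\<close> (\<open>psi_vec_closed_loop\<close>). Its joint kernel \<open>W\<close>, the range of \<open>T\<^sub>\<eta>\<close>, is invariant, and since the
  poles \<open>- \<alpha>\<^sub>j\<close> of the cascade are negative, any eigenvector with \<open>Re \<mu> \<ge> 0\<close> lies in \<open>W\<close>
  (\<open>real_eigenpair_annihilates_decaying_chain\<close>). So only the dynamics on \<open>W\<close> have to be stabilized, and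
  \<open>(\<Gamma>\<^sub>\<eta>, T\<^sub>\<eta>\<^sup>T B L_perp)\<close> is exactly the restriction of \<open>(A - B K\<^sub>0, B L_perp)\<close> to \<open>W\<close>
  in the basis \<open>T\<^sub>\<eta> (T\<^sub>\<eta>\<^sup>T T\<^sub>\<eta>)\<^sup>-\<^sup>1\<close> (\<open>stabilizable_iff_restriction\<close>).

  That a Hurwitz matrix gives exponential decay follows from a Schur decomposition and estimates for
  scalar equations solved one after the other (\<open>forced_scalar_decay\<close>, \<open>triangular_system_decay\<close>);
  conversely an eigenvector with \<open>Re \<mu> \<ge> 0\<close> yields a solution that does not decay.
\<close>

section \<open>Injective matrices, spans and Gram matrices\<close>

lemma lin_indpt_family_cols_imp_injective:
  assumes M: "M \<in> carrier_mat n k" and indpt: "lin_indpt_family n (col M) {0..<k}"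
    and v: "v \<in> carrier_vec k" and Mv: "M *\<^sub>v v = 0\<^sub>v n"
  shows "v = 0\<^sub>v k"
proof (rule ccontr)
  assume "v \<noteq> 0\<^sub>v k"
  moreover have "distinct (cols M)" "set (cols M) = col M ` {0..<k}"
    using indpt M by (auto simp: lin_indpt_family_def cols_def distinct_map)
  ultimately have "\<not> real_lin_indpt n (col M ` {0..<k})"
    using vec_space.lin_depI[OF M v _ Mv] by metis
  with indpt show False by (simp add: lin_indpt_family_def)
qed

lemma real_span_cols_eq_range:
  assumes "M \<in> carrier_mat n k"
  shows "real_span n (set (cols M)) = (\<lambda>w. M *\<^sub>v w) ` carrier_vec k"
  using vec_space.col_space_eq[OF assms] assms unfolding vec_space.col_space_def by force

lemma real_scalar_prod_self_ge_0: "(v :: real vec) \<bullet> v \<ge> 0"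
  by (auto simp: scalar_prod_def intro!: sum_nonneg)

lemma real_scalar_prod_self_eq_0:
  assumes "(v :: real vec) \<in> carrier_vec n" "v \<bullet> v = 0"
  shows "v = 0\<^sub>v n"
proof (rule eq_vecI)
  fix i assume i: "i < dim_vec (0\<^sub>v n :: real vec)"
  have "\<forall>i\<in>{0..<dim_vec v}. v $ i * v $ i = 0"
    using assms by (subst sum_nonneg_eq_0_iff[symmetric]) (auto simp: scalar_prod_def)
  then show "v $ i = 0\<^sub>v n $ i" using i assms by auto
qed (use assms in auto)

text \<open>If \<open>M\<close> is injective then so is \<open>M\<^sup>T * M\<close>, because \<open>v \<bullet> M\<^sup>T M v\<close> is the squared length of \<open>M v\<close>.
  This makes sense of \<open>(L\<^sup>T L)\<^sup>-\<^sup>1\<close> and \<open>(T\<^sub>\<eta>\<^sup>T T\<^sub>\<eta>)\<^sup>-\<^sup>1\<close>.\<close>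

lemma inv_mat_gram:
  fixes M :: "real mat"
  assumes M: "M \<in> carrier_mat n k"
    and inj: "\<And>v. v \<in> carrier_vec k \<Longrightarrow> M *\<^sub>v v = 0\<^sub>v n \<Longrightarrow> v = 0\<^sub>v k"
  shows "inv_mat (M\<^sup>T * M) \<in> carrier_mat k k"
    and "(M\<^sup>T * M) * inv_mat (M\<^sup>T * M) = 1\<^sub>m k"
    and "inv_mat (M\<^sup>T * M) * (M\<^sup>T * M) = 1\<^sub>m k"
proof -
  have S: "M\<^sup>T * M \<in> carrier_mat k k" using M by auto
  have "v = 0\<^sub>v k" if v: "v \<in> carrier_vec k" and "(M\<^sup>T * M) *\<^sub>v v = 0\<^sub>v k" for v
  proof -
    have Mv: "M *\<^sub>v v \<in> carrier_vec n" using M v by auto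
    have "(M *\<^sub>v v) \<bullet> (M *\<^sub>v v) = (M\<^sup>T *\<^sub>v (M *\<^sub>v v)) \<bullet> v"
      using transpose_vec_mult_scalar[OF M v Mv] by simp
    also have "M\<^sup>T *\<^sub>v (M *\<^sub>v v) = 0\<^sub>v k"
      using that M by (subst assoc_mult_mat_vec[symmetric, of _ k n _ k]) auto
    finally show ?thesis
      using v inj real_scalar_prod_self_eq_0[OF Mv] by simp
  qed
  then have "det (M\<^sup>T * M) \<noteq> 0" using det_0_iff_vec_prod_zero[OF S] by blast
  then have "M\<^sup>T * M \<in> Units (ring_mat TYPE(real) k ())" by (rule det_non_zero_imp_unit[OF S])
  then obtain N where "mat_inverse (M\<^sup>T * M) = Some N"
    using mat_inverse(1)[OF S, where b = "()"] by (cases "mat_inverse (M\<^sup>T * M)") auto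
  with mat_inverse(2)[OF S this]
  show "inv_mat (M\<^sup>T * M) \<in> carrier_mat k k"
    "(M\<^sup>T * M) * inv_mat (M\<^sup>T * M) = 1\<^sub>m k" "inv_mat (M\<^sup>T * M) * (M\<^sup>T * M) = 1\<^sub>m k"
    by (auto simp: inv_mat_def)
qed

lemma mat_eqI_mult_vec:
  fixes X Y :: "real mat"
  assumes X: "X \<in> carrier_mat n k" and Y: "Y \<in> carrier_mat n k"
    and eq: "\<And>v. v \<in> carrier_vec k \<Longrightarrow> X *\<^sub>v v = Y *\<^sub>v v"
  shows "X = Y"
proof (rule eq_matI)
  fix i j assume ij: "i < dim_row Y" "j < dim_col Y"
  then have "(X *\<^sub>v unit_vec k j) $ i = (Y *\<^sub>v unit_vec k j) $ i"
    using eq Y by simp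
  then show "X $$ (i, j) = Y $$ (i, j)" using ij X Y by (simp add: row_def)
qed (use X Y in auto)

lemma factor_through_range:
  fixes X M :: "real mat"
  assumes X: "X \<in> carrier_mat m n" and M: "M \<in> carrier_mat m q"
    and range: "\<And>j. j < n \<Longrightarrow> col X j \<in> (\<lambda>w. M *\<^sub>v w) ` carrier_vec q"
  shows "\<exists>Y \<in> carrier_mat q n. X = M * Y"
proof -
  have "\<forall>j<n. \<exists>w \<in> carrier_vec q. col X j = M *\<^sub>v w" using range by blast
  then obtain w where w: "\<And>j. j < n \<Longrightarrow> w j \<in> carrier_vec q \<and> col X j = M *\<^sub>v w j" by metis
  define Y where "Y = mat q n (\<lambda>(i, j). w j $ i)"
  have Y: "Y \<in> carrier_mat q n" by (simp add: Y_def)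
  have "X = M * Y"
  proof (rule mat_col_eqI)
    fix j assume j: "j < dim_col (M * Y)"
    then have j: "j < n" using Y by simp
    have "col Y j = w j" using w[OF j] j by (auto simp: Y_def)
    then show "col X j = col (M * Y) j" using w[OF j] col_mult2[OF M Y j] by simp
  qed (use X M Y in auto)
  with Y show ?thesis by blast
qed

section \<open>Eigenvalues in real coordinates\<close>

text \<open>The eigenvalue equation \<open>M (x + i y) = (a + i b) (x + i y)\<close> split into real and imaginary parts.
  With it, spectral arguments about a real matrix stay within real matrices, so that real changes of
  coordinates and real invariant subspaces apply without complexification.\<close>

definition real_eigenpair :: "real mat \<Rightarrow> real \<Rightarrow> real \<Rightarrow> real vec \<Rightarrow> real vec \<Rightarrow> bool" where
  "real_eigenpair M a b x y \<longleftrightarrow>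
     x \<in> carrier_vec (dim_row M) \<and> y \<in> carrier_vec (dim_row M) \<and>
     (x \<noteq> 0\<^sub>v (dim_row M) \<or> y \<noteq> 0\<^sub>v (dim_row M)) \<and>
     M *\<^sub>v x = a \<cdot>\<^sub>v x - b \<cdot>\<^sub>v y \<and> M *\<^sub>v y = b \<cdot>\<^sub>v x + a \<cdot>\<^sub>v y"

lemma complex_eigenvector_iff_real_eigenpair:
  assumes M: "M \<in> carrier_mat n n" and v: "v \<in> carrier_vec n"
  shows "eigenvector (map_mat complex_of_real M) v \<mu> \<longleftrightarrow>
    real_eigenpair M (Re \<mu>) (Im \<mu>) (map_vec Re v) (map_vec Im v)"
proof -
  let ?C = "map_mat complex_of_real M" and ?x = "map_vec Re v" and ?y = "map_vec Im v"
  have entry: "(?C *\<^sub>v v) $ i = Complex ((M *\<^sub>v ?x) $ i) ((M *\<^sub>v ?y) $ i)" if "i < n" for i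
    using that M v by (simp add: complex_eq_iff scalar_prod_def)
  have "?C *\<^sub>v v = \<mu> \<cdot>\<^sub>v v \<longleftrightarrow> (\<forall>i<n. (?C *\<^sub>v v) $ i = \<mu> * v $ i)"
    using M v by (auto simp: vec_eq_iff)
  also have "\<dots> \<longleftrightarrow> (\<forall>i<n. (M *\<^sub>v ?x) $ i = Re \<mu> * ?x $ i - Im \<mu> * ?y $ i
      \<and> (M *\<^sub>v ?y) $ i = Im \<mu> * ?x $ i + Re \<mu> * ?y $ i)"
    using v by (auto simp: entry complex_eq_iff)
  also have "\<dots> \<longleftrightarrow> M *\<^sub>v ?x = Re \<mu> \<cdot>\<^sub>v ?x - Im \<mu> \<cdot>\<^sub>v ?y \<and> M *\<^sub>v ?y = Im \<mu> \<cdot>\<^sub>v ?x + Re \<mu> \<cdot>\<^sub>v ?y"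
    using M v by (auto simp: vec_eq_iff)
  finally have 1: "?C *\<^sub>v v = \<mu> \<cdot>\<^sub>v v \<longleftrightarrow> \<dots>" .
  have 2: "v \<noteq> 0\<^sub>v n \<longleftrightarrow> ?x \<noteq> 0\<^sub>v n \<or> ?y \<noteq> 0\<^sub>v n"
    using v by (auto simp: vec_eq_iff complex_eq_iff)
  show ?thesis
    unfolding eigenvector_def real_eigenpair_def using M v 1 2 by auto
qed

lemma hurwitz_iff_real_eigenpair:
  assumes M: "M \<in> carrier_mat n n"
  shows "hurwitz M \<longleftrightarrow> (\<forall>a b x y. real_eigenpair M a b x y \<longrightarrow> a < 0)"
proof
  assume H: "hurwitz M"
  show "\<forall>a b x y. real_eigenpair M a b x y \<longrightarrow> a < 0"
  proof (intro allI impI)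
    fix a b x y assume E: "real_eigenpair M a b x y"
    define v where "v = vec n (\<lambda>i. Complex (x $ i) (y $ i))"
    have "map_vec Re v = x" "map_vec Im v = y"
      using E M by (auto simp: v_def real_eigenpair_def)
    then have "eigenvector (map_mat complex_of_real M) v (Complex a b)"
      using complex_eigenvector_iff_real_eigenpair[OF M, of v "Complex a b"] E
      by (simp add: v_def)
    with H show "a < 0" by (auto simp: hurwitz_def eigenvalue_def)
  qed
next
  assume "\<forall>a b x y. real_eigenpair M a b x y \<longrightarrow> a < 0"
  then show "hurwitz M"
    using M complex_eigenvector_iff_real_eigenpair[OF M]
    by (fastforce simp: hurwitz_def eigenvalue_def eigenvector_def)
qed

text \<open>An injective \<open>T\<close> with \<open>M T = T N\<close> identifies \<open>N\<close> with the restriction of \<open>M\<close> to the range of \<open>T\<close>,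
  so it carries eigenvectors of \<open>N\<close> to those eigenvectors of \<open>M\<close> that lie in the range.\<close>

lemma real_eigenpair_intertwine:
  assumes M: "M \<in> carrier_mat n n" and N: "N \<in> carrier_mat k k" and T: "T \<in> carrier_mat n k"
    and inj: "\<And>v. v \<in> carrier_vec k \<Longrightarrow> T *\<^sub>v v = 0\<^sub>v n \<Longrightarrow> v = 0\<^sub>v k"
    and MT: "M * T = T * N"
    and x: "x \<in> carrier_vec k" and y: "y \<in> carrier_vec k"
  shows "real_eigenpair M a b (T *\<^sub>v x) (T *\<^sub>v y) \<longleftrightarrow> real_eigenpair N a b x y"
proof -
  have move: "M *\<^sub>v (T *\<^sub>v w) = T *\<^sub>v (N *\<^sub>v w)" if "w \<in> carrier_vec k" for w
    using that M N T MT by (metis assoc_mult_mat_vec)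
  have cancel: "T *\<^sub>v u = T *\<^sub>v w \<longleftrightarrow> u = w" if u: "u \<in> carrier_vec k" and w: "w \<in> carrier_vec k" for u w
  proof
    assume "T *\<^sub>v u = T *\<^sub>v w"
    then have "T *\<^sub>v (u - w) = 0\<^sub>v n"
      using T u w by (subst mult_minus_distrib_mat_vec[OF T u w]) auto
    then have "u - w = 0\<^sub>v k" using inj u w by auto
    then show "u = w" using u w by (auto simp: vec_eq_iff)
  qed auto
  have T0: "T *\<^sub>v 0\<^sub>v k = 0\<^sub>v n" using T by auto
  have comb: "a \<cdot>\<^sub>v (T *\<^sub>v x) - b \<cdot>\<^sub>v (T *\<^sub>v y) = T *\<^sub>v (a \<cdot>\<^sub>v x - b \<cdot>\<^sub>v y)"
    "b \<cdot>\<^sub>v (T *\<^sub>v x) + a \<cdot>\<^sub>v (T *\<^sub>v y) = T *\<^sub>v (b \<cdot>\<^sub>v x + a \<cdot>\<^sub>v y)"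
    using T x y by (simp_all add: mult_minus_distrib_mat_vec[OF T] mult_add_distrib_mat_vec[OF T] mult_mat_vec[OF T])
  have z: "T *\<^sub>v w = 0\<^sub>v n \<longleftrightarrow> w = 0\<^sub>v k" if "w \<in> carrier_vec k" for w
    using inj[OF that] T0 by auto
  show ?thesis
    unfolding real_eigenpair_def
    using M N T x y z[OF x] z[OF y]
    by (simp add: comb move cancel)
qed

section \<open>Stabilizability and invariant subspaces\<close>

text \<open>Suppose that the range \<open>W\<close> of \<open>T\<close> is invariant under the closed loop and contains every eigenvector
  belonging to an eigenvalue with nonnegative real part. Then only the restriction to \<open>W\<close> matters for
  stability. The columns of \<open>R = T (T\<^sup>T T)\<^sup>-\<^sup>1\<close> form the basis of \<open>W\<close> dual to the columns of \<open>T\<close>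
  (\<open>T\<^sup>T R = 1\<close>), and in this basis the restriction has the matrix \<open>T\<^sup>T (M - G H) R\<close>, which is the one on
  the right-hand side. So no basis of a complement of \<open>W\<close> has to be chosen.\<close>

lemma hurwitz_closed_loop_iff_restriction:
  fixes M G H T :: "real mat"
  assumes M: "M \<in> carrier_mat n n" and G: "G \<in> carrier_mat n q" and H: "H \<in> carrier_mat q n"
    and T: "T \<in> carrier_mat n k"
    and inj: "\<And>v. v \<in> carrier_vec k \<Longrightarrow> T *\<^sub>v v = 0\<^sub>v n \<Longrightarrow> v = 0\<^sub>v k"
    and invariant: "\<And>x. x \<in> (\<lambda>w. T *\<^sub>v w) ` carrier_vec k \<Longrightarrow>
      (M - G * H) *\<^sub>v x \<in> (\<lambda>w. T *\<^sub>v w) ` carrier_vec k"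
    and transverse: "\<And>a b x y. real_eigenpair (M - G * H) a b x y \<Longrightarrow> a \<ge> 0 \<Longrightarrow>
      x \<in> (\<lambda>w. T *\<^sub>v w) ` carrier_vec k \<and> y \<in> (\<lambda>w. T *\<^sub>v w) ` carrier_vec k"
  shows "hurwitz (M - G * H) \<longleftrightarrow>
    hurwitz (T\<^sup>T * M * T * inv_mat (T\<^sup>T * T) - T\<^sup>T * G * (H * (T * inv_mat (T\<^sup>T * T))))"
proof -
  define J where "J = inv_mat (T\<^sup>T * T)"
  define R where "R = T * J"
  define N where "N = M - G * H"
  define N' where "N' = T\<^sup>T * M * T * J - T\<^sup>T * G * (H * R)"
  let ?W = "(\<lambda>w. T *\<^sub>v w) ` carrier_vec k"
  note gram = inv_mat_gram[OF T inj, folded J_def]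
  have J: "J \<in> carrier_mat k k" by (rule gram(1))
  have R: "R \<in> carrier_mat n k" using T J by (simp add: R_def)
  have Tt: "T\<^sup>T \<in> carrier_mat k n" using T by simp
  have N: "N \<in> carrier_mat n n" using minus_carrier_mat[OF mult_carrier_mat[OF G H]] by (simp add: N_def)
  have N': "N' \<in> carrier_mat k k" unfolding N'_def
    by (intro minus_carrier_mat mult_carrier_mat[OF mult_carrier_mat[OF Tt G] mult_carrier_mat[OF H R]])
  have N'_eq: "N' = T\<^sup>T * (N * R)"
  proof -
    have "T\<^sup>T * (N * R) = T\<^sup>T * (M * R - G * H * R)"
      using M G H R by (simp add: N_def minus_mult_distrib_mat)
    also have "\<dots> = T\<^sup>T * (M * R) - T\<^sup>T * (G * H * R)"
      by (rule mult_minus_distrib_mat[OF Tt mult_carrier_mat[OF M R]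
          mult_carrier_mat[OF mult_carrier_mat[OF G H] R]])
    also have "T\<^sup>T * (M * R) = T\<^sup>T * M * T * J"
      using Tt M T J unfolding R_def
      by (simp add: assoc_mult_mat[of _ k n _ n] assoc_mult_mat[of _ n n _ k] assoc_mult_mat[of _ k n _ k])
    also have "T\<^sup>T * (G * H * R) = T\<^sup>T * G * (H * R)"
      by (simp only: assoc_mult_mat[OF G H R] assoc_mult_mat[OF Tt G mult_carrier_mat[OF H R]])
    finally show ?thesis by (simp add: N'_def)
  qed
  have TtR: "T\<^sup>T * R = 1\<^sub>m k"
    using gram(2) Tt T J unfolding R_def by (simp add: assoc_mult_mat[of _ k n _ k])
  have Rinj: "v = 0\<^sub>v k" if v: "v \<in> carrier_vec k" "R *\<^sub>v v = 0\<^sub>v n" for v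
  proof -
    have "v = (T\<^sup>T * R) *\<^sub>v v" using v by (simp add: TtR)
    also have "\<dots> = T\<^sup>T *\<^sub>v 0\<^sub>v n" using v by (simp add: assoc_mult_mat_vec[OF Tt R])
    also have "\<dots> = 0\<^sub>v k" using T by (intro eq_vecI) auto
    finally show ?thesis .
  qed
  have T_eq_R: "T *\<^sub>v w = R *\<^sub>v ((T\<^sup>T * T) *\<^sub>v w)" if w: "w \<in> carrier_vec k" for w
  proof -
    have "R *\<^sub>v ((T\<^sup>T * T) *\<^sub>v w) = T *\<^sub>v (J *\<^sub>v ((T\<^sup>T * T) *\<^sub>v w))"
      unfolding R_def using T J w by (intro assoc_mult_mat_vec) auto
    also have "J *\<^sub>v ((T\<^sup>T * T) *\<^sub>v w) = (J * (T\<^sup>T * T)) *\<^sub>v w"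
      using T J w by (intro assoc_mult_mat_vec[symmetric]) auto
    finally show ?thesis using gram(3) w by simp
  qed
  have W_R: "\<exists>z \<in> carrier_vec k. x = R *\<^sub>v z" if "x \<in> ?W" for x
  proof -
    from that obtain w where w: "w \<in> carrier_vec k" "x = T *\<^sub>v w" by blast
    have "(T\<^sup>T * T) *\<^sub>v w \<in> carrier_vec k" using T w by simp
    with T_eq_R[OF w(1)] w(2) show ?thesis by blast
  qed
  have R_W: "R *\<^sub>v z \<in> ?W" if "z \<in> carrier_vec k" for z
    using mult_mat_vec_carrier[OF J that] unfolding R_def assoc_mult_mat_vec[OF T J that] by blast
  have proj: "R *\<^sub>v (T\<^sup>T *\<^sub>v x) = x" if x: "x \<in> ?W" for x
  proof -
    obtain z where z: "z \<in> carrier_vec k" "x = R *\<^sub>v z" using W_R[OF x] by blast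
    have "T\<^sup>T *\<^sub>v x = z"
      using z assoc_mult_mat_vec[OF Tt R z(1)] by (simp add: TtR)
    with z show ?thesis by simp
  qed
  \<comment> \<open>\<open>R T\<^sup>T\<close> fixes every vector of \<open>W\<close>, and \<open>N R\<close> has its columns in \<open>W\<close> by invariance.\<close>
  have "N * R = R * N'"
  proof (rule mat_eqI_mult_vec)
    fix v :: "real vec" assume v: "v \<in> carrier_vec k"
    have "(R * N') *\<^sub>v v = R *\<^sub>v (N' *\<^sub>v v)" by (rule assoc_mult_mat_vec[OF R N' v])
    also have "N' *\<^sub>v v = T\<^sup>T *\<^sub>v (N *\<^sub>v (R *\<^sub>v v))"
      unfolding N'_eq
      by (simp only: assoc_mult_mat_vec[OF Tt mult_carrier_mat[OF N R] v] assoc_mult_mat_vec[OF N R v])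
    also have "R *\<^sub>v \<dots> = N *\<^sub>v (R *\<^sub>v v)"
      using invariant[OF R_W[OF v]] unfolding N_def by (rule proj)
    finally show "(N * R) *\<^sub>v v = (R * N') *\<^sub>v v"
      by (simp only: assoc_mult_mat_vec[OF N R v])
  qed (use N R N' in auto)
  note intertwine = real_eigenpair_intertwine[OF N N' R Rinj this]
  have "hurwitz N \<longleftrightarrow> hurwitz N'"
    unfolding hurwitz_iff_real_eigenpair[OF N] hurwitz_iff_real_eigenpair[OF N']
  proof (intro iffI allI impI)
    fix a b x y assume "\<forall>a b x y. real_eigenpair N a b x y \<longrightarrow> a < 0" and E: "real_eigenpair N' a b x y"
    moreover have "x \<in> carrier_vec k" "y \<in> carrier_vec k"
      using E N' by (auto simp: real_eigenpair_def)
    ultimately show "a < 0" using intertwine[of x y a b] by metis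
  next
    fix a b x y
    assume N'_neg: "\<forall>a b x y. real_eigenpair N' a b x y \<longrightarrow> a < 0" and E: "real_eigenpair N a b x y"
    show "a < 0"
    proof (rule ccontr)
      assume "\<not> a < 0"
      then have "x \<in> ?W" "y \<in> ?W" using transverse E by (auto simp: N_def)
      then obtain z w where "z \<in> carrier_vec k" "x = R *\<^sub>v z" "w \<in> carrier_vec k" "y = R *\<^sub>v w"
        using W_R by metis
      with E N'_neg intertwine[of z w a b] have "a < 0" by metis
      with \<open>\<not> a < 0\<close> show False by simp
    qed
  qed
  then show ?thesis by (simp add: N_def N'_def R_def J_def)
qed

text \<open>Feedback gains correspond in both directions: \<open>H\<close> on the whole space restricts to \<open>H R\<close>, and a gain
  \<open>H'\<close> in the coordinates of \<open>R\<close> extends to \<open>H' T\<^sup>T\<close>, which restricts to \<open>H'\<close> again since \<open>T\<^sup>T R = 1\<close>.\<close>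

lemma stabilizable_iff_restriction:
  fixes M G T :: "real mat"
  assumes M: "M \<in> carrier_mat n n" and G: "G \<in> carrier_mat n q" and T: "T \<in> carrier_mat n k"
    and inj: "\<And>v. v \<in> carrier_vec k \<Longrightarrow> T *\<^sub>v v = 0\<^sub>v n \<Longrightarrow> v = 0\<^sub>v k"
    and invariant: "\<And>H x. H \<in> carrier_mat q n \<Longrightarrow> x \<in> (\<lambda>w. T *\<^sub>v w) ` carrier_vec k \<Longrightarrow>
      (M - G * H) *\<^sub>v x \<in> (\<lambda>w. T *\<^sub>v w) ` carrier_vec k"
    and transverse: "\<And>H a b x y. H \<in> carrier_mat q n \<Longrightarrow> real_eigenpair (M - G * H) a b x y \<Longrightarrow>
      a \<ge> 0 \<Longrightarrow> x \<in> (\<lambda>w. T *\<^sub>v w) ` carrier_vec k \<and> y \<in> (\<lambda>w. T *\<^sub>v w) ` carrier_vec k"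
  shows "stabilizable (T\<^sup>T * M * T * inv_mat (T\<^sup>T * T)) (T\<^sup>T * G) \<longleftrightarrow> stabilizable M G"
proof -
  let ?R = "T * inv_mat (T\<^sup>T * T)"
  note gram = inv_mat_gram[OF T inj]
  have R: "?R \<in> carrier_mat n k" using T gram(1) by simp
  have "T\<^sup>T * ?R = (T\<^sup>T * T) * inv_mat (T\<^sup>T * T)"
    using T gram(1) by (intro assoc_mult_mat[symmetric]) auto
  then have TtR: "T\<^sup>T * ?R = 1\<^sub>m k" using gram(2) by simp
  have iff: "hurwitz (M - G * H) \<longleftrightarrow>
      hurwitz (T\<^sup>T * M * T * inv_mat (T\<^sup>T * T) - T\<^sup>T * G * (H * ?R))"
    if "H \<in> carrier_mat q n" for H
    by (rule hurwitz_closed_loop_iff_restriction[OF M G that T])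
      (assumption | rule that inj invariant transverse)+
  show ?thesis
  proof
    assume "stabilizable (T\<^sup>T * M * T * inv_mat (T\<^sup>T * T)) (T\<^sup>T * G)"
    then obtain H' where H': "H' \<in> carrier_mat q k"
      and hw: "hurwitz (T\<^sup>T * M * T * inv_mat (T\<^sup>T * T) - T\<^sup>T * G * H')"
      using G T by (auto simp: stabilizable_def)
    have "H' * T\<^sup>T * ?R = H'"
      using H' T R TtR by (simp add: assoc_mult_mat[of _ q k _ n _ k])
    then have "hurwitz (M - G * (H' * T\<^sup>T))"
      using iff[of "H' * T\<^sup>T"] hw H' T by simp
    moreover have "H' * T\<^sup>T \<in> carrier_mat q n" using H' T by simp
    ultimately show "stabilizable M G"
      using G M unfolding stabilizable_def by blast
  next
    assume "stabilizable M G"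
    then obtain H where H: "H \<in> carrier_mat q n" and "hurwitz (M - G * H)"
      using G M by (auto simp: stabilizable_def)
    then have "hurwitz (T\<^sup>T * M * T * inv_mat (T\<^sup>T * T) - T\<^sup>T * G * (H * ?R))"
      using iff by blast
    moreover have "H * ?R \<in> carrier_mat q k" using H R by simp
    ultimately show "stabilizable (T\<^sup>T * M * T * inv_mat (T\<^sup>T * T)) (T\<^sup>T * G)"
      using G T unfolding stabilizable_def by auto
  qed
qed

section \<open>Exponential decay of triangular systems\<close>

lemma cnj_sgn_mult_self: "cnj (sgn z) * z = complex_of_real (norm z)"
proof (cases "z = 0")
  case False
  have "cnj (sgn z) * z = (z * cnj z) / of_real (norm z)"
    by (simp add: sgn_eq)
  also have "z * cnj z = of_real (norm z) * of_real (norm z)"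
    by (metis complex_norm_square power2_eq_square of_real_mult)
  finally show ?thesis using False by simp
qed simp

text \<open>Variation of constants as an inequality. For \<open>w(s) = exp (- \<mu> s) y(s)\<close> the derivative is
  \<open>exp (- \<mu> s) g(s)\<close>, of modulus at most \<open>C exp (\<sigma> s)\<close> with \<open>\<sigma> = - Re \<mu> - \<rho> > 0\<close>. The strict gap \<open>\<sigma>\<close> lets
  \<open>y\<close> decay at the same rate \<open>\<rho>\<close> as the forcing, without a polynomial factor.\<close>

lemma forced_scalar_decay:
  fixes y g :: "real \<Rightarrow> complex" and \<mu> :: complex and C \<rho> :: real
  assumes y: "\<And>t. t \<ge> 0 \<Longrightarrow> (y has_vector_derivative \<mu> * y t + g t) (at t within {0..})"
    and g: "\<And>t. t \<ge> 0 \<Longrightarrow> norm (g t) \<le> C * exp (- \<rho> * t)"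
    and \<mu>: "Re \<mu> < - \<rho>" and C: "C \<ge> 0" and t: "t \<ge> 0"
  shows "norm (y t) \<le> (norm (y 0) + C / (- Re \<mu> - \<rho>)) * exp (- \<rho> * t)"
proof (cases "t = 0")
  case True
  then show ?thesis using C \<mu> by simp
next
  case False
  define \<sigma> where "\<sigma> = - Re \<mu> - \<rho>"
  have \<sigma>: "\<sigma> > 0" using \<mu> by (simp add: \<sigma>_def)
  define w where "w s = exp (- \<mu> * of_real s) * y s" for s :: real
  \<comment> \<open>Projecting \<open>w\<close> to the direction of its total increment turns the complex mean value estimate
    into the monotonicity of a real function \<open>\<phi>\<close>.\<close>
  define u where "u = cnj (sgn (w t - w 0))"
  define \<phi> where "\<phi> s = Re (u * w s) - C / \<sigma> * exp (\<sigma> * s)" for s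
  have u: "norm u \<le> 1" by (simp add: u_def norm_sgn)
  have norm_w: "norm (exp (- \<mu> * of_real s) * z) = exp (- Re \<mu> * s) * norm z" for s z
    by (simp add: norm_mult mult.commute)
  have w: "(w has_vector_derivative exp (- \<mu> * of_real s) * g s) (at s within {0..})" if "s \<ge> 0" for s
  proof -
    have "((\<lambda>s. exp (- \<mu> * complex_of_real s)) has_vector_derivative - \<mu> * exp (- \<mu> * of_real s))
        (at s within {0..})"
      by (rule has_vector_derivative_real_field) (auto intro!: derivative_eq_intros)
    from has_vector_derivative_mult[OF this y[OF that]] show ?thesis
      by (simp add: w_def[abs_def] algebra_simps)
  qed
  have \<phi>: "(\<phi> has_real_derivative Re (u * (exp (- \<mu> * of_real s) * g s)) - C * exp (\<sigma> * s)) (at s within {0..})"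
    if "s \<ge> 0" for s
  proof -
    have "((\<lambda>s. Re (u * w s)) has_real_derivative Re (u * (exp (- \<mu> * of_real s) * g s))) (at s within {0..})"
      unfolding has_real_derivative_iff_has_vector_derivative
      by (intro bounded_linear.has_vector_derivative[OF bounded_linear_Re]
          has_vector_derivative_mult_right w that)
    moreover have "((\<lambda>s. C / \<sigma> * exp (\<sigma> * s)) has_real_derivative C * exp (\<sigma> * s)) (at s within {0..})"
      using \<sigma> by (auto intro!: derivative_eq_intros)
    ultimately show ?thesis unfolding \<phi>_def by (rule DERIV_diff)
  qed
  have exp_split: "exp (- Re \<mu> * s) * exp (- \<rho> * s) = exp (\<sigma> * s)" for s
    unfolding mult_exp_exp by (simp add: \<sigma>_def algebra_simps)
  have \<phi>_le: "Re (u * (exp (- \<mu> * of_real s) * g s)) \<le> C * exp (\<sigma> * s)" if "s \<ge> 0" for s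
  proof -
    have "Re (u * (exp (- \<mu> * of_real s) * g s)) \<le> norm u * norm (exp (- \<mu> * of_real s) * g s)"
      using complex_Re_le_cmod by (simp only: norm_mult[symmetric])
    also have "\<dots> \<le> 1 * norm (exp (- \<mu> * of_real s) * g s)"
      by (intro mult_right_mono u) auto
    also have "\<dots> = exp (- Re \<mu> * s) * norm (g s)" by (simp only: norm_w mult_1_left)
    also have "\<dots> \<le> exp (- Re \<mu> * s) * (C * exp (- \<rho> * s))"
      by (intro mult_left_mono g that) auto
    also have "\<dots> = C * exp (\<sigma> * s)"
      by (simp add: exp_split[symmetric])
    finally show ?thesis .
  qed
  have "\<phi> t \<le> \<phi> 0"
  proof (rule DERIV_nonpos_imp_decreasing_open[of 0 t \<phi>])
    show "0 \<le> t" by (rule t)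
    fix s assume s: "0 < s" "s < t"
    have "at s within {0..} = at s"
      using s by (intro at_within_nhd[of s "{0<..}"]) auto
    with s \<phi>[of s] \<phi>_le[of s] show "\<exists>D. DERIV \<phi> s :> D \<and> D \<le> 0" by auto
  next
    have "continuous_on {0..} \<phi>"
      using \<phi> by (auto simp: continuous_on_eq_continuous_within intro: DERIV_continuous)
    then show "continuous_on {0..t} \<phi>" by (rule continuous_on_subset) auto
  qed
  moreover have "Re (u * w t) - Re (u * w 0) = norm (w t - w 0)"
  proof -
    have "u * (w t - w 0) = norm (w t - w 0)"
      unfolding u_def by (rule cnj_sgn_mult_self)
    then have "Re (u * (w t - w 0)) = norm (w t - w 0)" by (simp only: Re_complex_of_real)
    then show ?thesis by (simp only: right_diff_distrib minus_complex.simps)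
  qed
  ultimately have "norm (w t - w 0) \<le> C / \<sigma> * exp (\<sigma> * t)"
    using divide_nonneg_pos[OF C \<sigma>] by (simp add: \<phi>_def)
  moreover have "norm (w t) \<le> norm (w 0) + norm (w t - w 0)" by (rule norm_triangle_sub)
  moreover have "norm (w t) = exp (- Re \<mu> * t) * norm (y t)" "norm (w 0) = norm (y 0)"
    unfolding w_def by (simp_all only: norm_w) simp
  ultimately have "exp (- Re \<mu> * t) * norm (y t) \<le> norm (y 0) + C / \<sigma> * exp (\<sigma> * t)" by simp
  also have "\<dots> \<le> norm (y 0) * exp (\<sigma> * t) + C / \<sigma> * exp (\<sigma> * t)"
    using \<sigma> t by (simp add: mult_le_cancel_left1)
  also have "\<dots> = exp (- Re \<mu> * t) * ((norm (y 0) + C / \<sigma>) * exp (- \<rho> * t))"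
    by (simp only: exp_split[symmetric] distrib_left distrib_right mult_ac)
  finally show ?thesis by (simp add: \<sigma>_def)
qed

text \<open>Back substitution: the last component solves an unforced scalar equation, and each earlier one is
  forced by the later ones, so the previous estimate applies successively and keeps the rate \<open>\<rho>\<close>.\<close>

lemma triangular_system_decay:
  fixes U :: "nat \<Rightarrow> nat \<Rightarrow> complex" and \<rho> :: real
  assumes diag: "\<And>k. k < n \<Longrightarrow> Re (U k k) < - \<rho>"
  shows "\<exists>C\<ge>0. \<forall>z. (\<forall>k<n. \<forall>t\<ge>0.
      (z k has_vector_derivative (\<Sum>j = k..<n. U k j * z j t)) (at t within {0..})) \<longrightarrow>
    (\<forall>k<n. \<forall>t\<ge>0. norm (z k t) \<le> C * (\<Sum>j<n. norm (z j 0)) * exp (- \<rho> * t))"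
proof -
  define sol where "sol z \<longleftrightarrow> (\<forall>k<n. \<forall>t\<ge>0.
      (z k has_vector_derivative (\<Sum>j = k..<n. U k j * z j t)) (at t within {0..}))" for z
  define S where "S z = (\<Sum>j<n. norm (z j 0))" for z :: "nat \<Rightarrow> real \<Rightarrow> complex"
  have S: "S z \<ge> 0" for z unfolding S_def by (intro sum_nonneg) simp
  \<comment> \<open>Induction on the number \<open>i\<close> of components, counted from the last one, that are already bounded.\<close>
  have "\<exists>C\<ge>0. \<forall>z. sol z \<longrightarrow> (\<forall>k<n. n - i \<le> k \<longrightarrow>
      (\<forall>t\<ge>0. norm (z k t) \<le> C * S z * exp (- \<rho> * t)))" for i
  proof (induction i)
    case 0
    show ?case by (intro exI[of _ 0]) auto
  next
    case (Suc i)
    then obtain C where C: "C \<ge> 0" and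
      dec: "\<And>z k t. sol z \<Longrightarrow> k < n \<Longrightarrow> n - i \<le> k \<Longrightarrow> t \<ge> 0 \<Longrightarrow>
        norm (z k t) \<le> C * S z * exp (- \<rho> * t)" by blast
    show ?case
    proof (cases "i < n")
      case False
      then have "n - Suc i = n - i" by simp
      then show ?thesis using C dec by metis
    next
      case True
      define k where "k = n - Suc i"
      have k: "k < n" "n - i = Suc k" using True by (auto simp: k_def)
      define E where "E = (\<Sum>j = Suc k..<n. norm (U k j)) * C"
      define D where "D = 1 + E / (- Re (U k k) - \<rho>)"
      have E: "E \<ge> 0" using C by (auto simp: E_def intro!: mult_nonneg_nonneg sum_nonneg)
      have D: "D \<ge> 0" using E diag[OF k(1)] by (simp add: D_def)
      have new: "norm (z k t) \<le> D * S z * exp (- \<rho> * t)" if z: "sol z" and t: "t \<ge> 0" for z t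
      proof -
        have "norm (z k t) \<le> (norm (z k 0) + E * S z / (- Re (U k k) - \<rho>)) * exp (- \<rho> * t)"
        proof (rule forced_scalar_decay[OF _ _ diag[OF k(1)] _ t])
          fix s :: real assume s: "s \<ge> 0"
          show "(z k has_vector_derivative U k k * z k s + (\<Sum>j = Suc k..<n. U k j * z j s)) (at s within {0..})"
            using z s k(1) by (simp add: sol_def sum.atLeast_Suc_lessThan)
          have "norm (\<Sum>j = Suc k..<n. U k j * z j s) \<le> (\<Sum>j = Suc k..<n. norm (U k j) * (C * S z * exp (- \<rho> * s)))"
            using dec[OF z _ _ s] k by (intro sum_norm_le) (auto simp: norm_mult intro!: mult_left_mono)
          also have "\<dots> = E * S z * exp (- \<rho> * s)"
            by (simp add: E_def sum_distrib_right mult.assoc)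
          finally show "norm (\<Sum>j = Suc k..<n. U k j * z j s) \<le> E * S z * exp (- \<rho> * s)" .
        next
          show "E * S z \<ge> 0" using E S by (rule mult_nonneg_nonneg)
        qed
        also have "\<dots> \<le> D * S z * exp (- \<rho> * t)"
        proof (intro mult_right_mono)
          have "norm (z k 0) \<le> S z" unfolding S_def using k by (intro member_le_sum) auto
          then show "norm (z k 0) + E * S z / (- Re (U k k) - \<rho>) \<le> D * S z"
            unfolding D_def distrib_right by simp
        qed simp
        finally show ?thesis .
      qed
      have "norm (z l t) \<le> max C D * S z * exp (- \<rho> * t)"
        if z: "sol z" and l: "l < n" "n - Suc i \<le> l" and t: "t \<ge> 0" for z l t
      proof -
        have "norm (z l t) \<le> (if l = k then D else C) * S z * exp (- \<rho> * t)"
          using new[OF z t] dec[OF z l(1) _ t] l k by (auto simp: k_def)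
        also have "\<dots> \<le> max C D * S z * exp (- \<rho> * t)"
          using S by (intro mult_right_mono) auto
        finally show ?thesis .
      qed
      moreover have "max C D \<ge> 0" using C by simp
      ultimately show ?thesis by blast
    qed
  qed
  from this[of n] show ?thesis by (simp add: sol_def S_def)
qed

section \<open>Exponential stability and the Hurwitz property\<close>

text \<open>The transformation to triangular form need not preserve the Euclidean norm exactly; the norm is only
  compared up to constants, for which the sum norm is the easiest to estimate.\<close>

definition l1_norm :: "complex vec \<Rightarrow> real" where
  "l1_norm v = (\<Sum>i<dim_vec v. norm (v $ i))"

lemma l1_norm_mult_mat_vec_le:
  assumes A: "A \<in> carrier_mat m n"
  shows "\<exists>C\<ge>0. \<forall>v\<in>carrier_vec n. l1_norm (A *\<^sub>v v) \<le> C * l1_norm v"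
proof (intro exI conjI ballI)
  let ?C = "\<Sum>i<m. \<Sum>j<n. norm (A $$ (i, j))"
  show "?C \<ge> 0" by (intro sum_nonneg) simp
  fix v :: "complex vec" assume v: "v \<in> carrier_vec n"
  have "norm ((A *\<^sub>v v) $ i) \<le> (\<Sum>j<n. norm (A $$ (i, j)) * l1_norm v)" if i: "i < m" for i
  proof -
    have "(A *\<^sub>v v) $ i = (\<Sum>j<n. A $$ (i, j) * v $ j)"
      using A v i by (simp add: scalar_prod_def atLeast0LessThan)
    also have "norm \<dots> \<le> (\<Sum>j<n. norm (A $$ (i, j)) * norm (v $ j))"
      by (rule sum_norm_le) (simp add: norm_mult)
    also have "\<dots> \<le> (\<Sum>j<n. norm (A $$ (i, j)) * l1_norm v)"
      unfolding l1_norm_def using v by (intro sum_mono mult_left_mono member_le_sum) auto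
    finally show ?thesis .
  qed
  then have "(\<Sum>i<m. norm ((A *\<^sub>v v) $ i)) \<le> (\<Sum>i<m. \<Sum>j<n. norm (A $$ (i, j)) * l1_norm v)"
    by (intro sum_mono) simp
  moreover have "l1_norm (A *\<^sub>v v) = (\<Sum>i<m. norm ((A *\<^sub>v v) $ i))"
    using A by (simp add: l1_norm_def)
  ultimately have "l1_norm (A *\<^sub>v v) \<le> (\<Sum>i<m. \<Sum>j<n. norm (A $$ (i, j)) * l1_norm v)" by simp
  then show "l1_norm (A *\<^sub>v v) \<le> ?C * l1_norm v"
    by (simp only: sum_distrib_right)
qed

lemma euclid_norm_le_l1_norm: "euclid_norm v \<le> l1_norm (map_vec complex_of_real v)"
proof -
  let ?s = "\<Sum>i<dim_vec v. \<bar>v $ i\<bar>"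
  have "v \<bullet> v = (\<Sum>i<dim_vec v. \<bar>v $ i\<bar> * \<bar>v $ i\<bar>)"
    by (simp add: scalar_prod_def atLeast0LessThan)
  also have "\<dots> \<le> (\<Sum>i<dim_vec v. \<bar>v $ i\<bar> * ?s)"
    by (intro sum_mono mult_left_mono member_le_sum) auto
  also have "\<dots> = ?s\<^sup>2" by (simp only: sum_distrib_right power2_eq_square)
  finally have "v \<bullet> v \<le> ?s\<^sup>2" .
  then have "euclid_norm v \<le> ?s"
    unfolding euclid_norm_def by (intro real_le_lsqrt sum_nonneg) auto
  then show ?thesis by (simp add: l1_norm_def)
qed

lemma abs_component_le_euclid_norm:
  assumes "i < dim_vec v"
  shows "\<bar>v $ i\<bar> \<le> euclid_norm v"
proof -
  have "v $ i * v $ i \<le> v \<bullet> v"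
    unfolding scalar_prod_def using assms by (intro member_le_sum) auto
  then show ?thesis
    unfolding euclid_norm_def by (intro real_le_rsqrt) (simp add: power2_eq_square)
qed

lemma l1_norm_le_euclid_norm:
  "l1_norm (map_vec complex_of_real v) \<le> real (dim_vec v) * euclid_norm v"
proof -
  have "(\<Sum>i<dim_vec v. \<bar>v $ i\<bar>) \<le> (\<Sum>i<dim_vec v. euclid_norm v)"
    by (intro sum_mono abs_component_le_euclid_norm) simp
  then show ?thesis by (simp add: l1_norm_def)
qed

lemma spectral_gap:
  fixes s :: "nat \<Rightarrow> real"
  assumes "\<And>k. k < n \<Longrightarrow> s k < 0"
  shows "\<exists>\<rho>>0. \<forall>k<n. s k < - \<rho>"
  using assms
proof (induction n)
  case (Suc n)
  then obtain \<rho> where \<rho>: "\<rho> > 0" "\<forall>k<n. s k < - \<rho>" by auto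
  have sn: "s n < 0" using Suc.prems by simp
  have "\<forall>k<Suc n. s k < - min \<rho> (- s n / 2)"
  proof (intro allI impI)
    fix k assume "k < Suc n"
    then consider "k < n" | "k = n" by linarith
    then show "s k < - min \<rho> (- s n / 2)" using \<rho> sn by cases auto
  qed
  moreover have "min \<rho> (- s n / 2) > 0" using \<rho> sn by simp
  ultimately show ?case by blast
qed (auto intro: exI[of _ 1])

text \<open>In the coordinates \<open>z = Q x\<close> of a Schur decomposition \<open>M = P U Q\<close> the system is triangular with the
  eigenvalues of \<open>M\<close> on the diagonal. Every rate \<open>\<rho>\<close> strictly below the spectral gap works, and the
  passage to \<open>z\<close> and back costs a constant factor.\<close>

lemma hurwitz_imp_globally_exp_stable:
  assumes M: "M \<in> carrier_mat n n" and hw: "hurwitz M"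
  shows "globally_exp_stable M"
proof -
  define Mc where "Mc = map_mat complex_of_real M"
  have Mc: "Mc \<in> carrier_mat n n" using M by (simp add: Mc_def)
  obtain es where es: "char_poly Mc = (\<Prod>a\<leftarrow>es. [:- a, 1:])"
    using char_poly_factorized[OF Mc] by blast
  obtain U P Q where UPQ: "schur_decomposition Mc es = (U, P, Q)"
    by (cases "schur_decomposition Mc es") auto
  note schur = schur_decomposition[OF Mc es UPQ]
  have wit: "similar_mat_wit Mc U P Q" and tri: "upper_triangular U" and diag: "diag_mat U = es"
    using schur by auto
  note simil = similar_mat_witD2[OF Mc wit]
  have U: "U \<in> carrier_mat n n" and P: "P \<in> carrier_mat n n" and Q: "Q \<in> carrier_mat n n"
    and PQ: "P * Q = 1\<^sub>m n" and QP: "Q * P = 1\<^sub>m n" and Mc_eq: "Mc = P * U * Q"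
    by (fact simil)+
  have "Re (U $$ (k, k)) < 0" if k: "k < n" for k
  proof -
    have "U $$ (k, k) \<in> set es" using k U unfolding diag[symmetric] by (simp add: diag_mat_def)
    then have "poly (char_poly Mc) (U $$ (k, k)) = 0"
      unfolding es by (induction es) auto
    then have "eigenvalue Mc (U $$ (k, k))" using eigenvalue_root_char_poly[OF Mc] by blast
    with hw show ?thesis by (simp add: hurwitz_def Mc_def)
  qed
  then obtain \<rho> where \<rho>: "\<rho> > 0" "\<And>k. k < n \<Longrightarrow> Re (U $$ (k, k)) < - \<rho>"
    using spectral_gap[of n "\<lambda>k. Re (U $$ (k, k))"] by auto
  obtain C where C: "C \<ge> 0" and decay: "\<forall>z. (\<forall>k<n. \<forall>t\<ge>0.
      (z k has_vector_derivative (\<Sum>j = k..<n. U $$ (k, j) * z j t)) (at t within {0..})) \<longrightarrow>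
      (\<forall>k<n. \<forall>t\<ge>0. norm (z k t) \<le> C * (\<Sum>j<n. norm (z j 0)) * exp (- \<rho> * t))"
    using triangular_system_decay[of n "\<lambda>k j. U $$ (k, j)" \<rho>] \<rho>(2) by blast
  obtain CP where CP: "CP \<ge> 0" "\<And>v. v \<in> carrier_vec n \<Longrightarrow> l1_norm (P *\<^sub>v v) \<le> CP * l1_norm v"
    using l1_norm_mult_mat_vec_le[OF P] by blast
  obtain CQ where CQ: "CQ \<ge> 0" "\<And>v. v \<in> carrier_vec n \<Longrightarrow> l1_norm (Q *\<^sub>v v) \<le> CQ * l1_norm v"
    using l1_norm_mult_mat_vec_le[OF Q] by blast
  define \<kappa> where "\<kappa> = CP * (real n * (C * (CQ * real n))) + 1"
  have "\<kappa> > 0" using CP(1) C CQ(1) unfolding \<kappa>_def by (intro add_nonneg_pos mult_nonneg_nonneg) auto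
  moreover have "euclid_norm (x t) \<le> \<kappa> * exp (- \<rho> * t) * euclid_norm (x 0)"
    if sol: "lin_ode_solution M x" and t: "t \<ge> 0" for x t
  proof -
    define X where "X t = map_vec complex_of_real (x t)" for t
    define z where "z k t = (Q *\<^sub>v X t) $ k" for k t
    have x: "x s \<in> carrier_vec n" if "s \<ge> 0" for s using sol that M by (auto simp: lin_ode_solution_def)
    have X: "X s \<in> carrier_vec n" if "s \<ge> 0" for s using x[OF that] by (simp add: X_def)
    have x': "((\<lambda>s. x s $ j) has_real_derivative (M *\<^sub>v x s) $ j) (at s within {0..})"
      if "j < n" "s \<ge> 0" for j s using sol that M by (auto simp: lin_ode_solution_def)
    have z': "(z k has_vector_derivative (\<Sum>j = k..<n. U $$ (k, j) * z j s)) (at s within {0..})"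
      if k: "k < n" and s: "s \<ge> 0" for k s
    proof -
      have "((\<lambda>s. \<Sum>j<n. Q $$ (k, j) * of_real (x s $ j)) has_vector_derivative
          (\<Sum>j<n. Q $$ (k, j) * of_real ((M *\<^sub>v x s) $ j))) (at s within {0..})"
        using x' s by (intro has_vector_derivative_sum has_vector_derivative_mult_right has_vector_derivative_of_real) auto
      then have "(z k has_vector_derivative (\<Sum>j<n. Q $$ (k, j) * of_real ((M *\<^sub>v x s) $ j))) (at s within {0..})"
        unfolding has_vector_derivative_def
      proof (rule has_derivative_transform[rotated 2])
        show "s \<in> {0..}" using s by simp
        fix s :: real assume "s \<in> {0..}"
        then have "s \<ge> 0" by simp
        then show "z k s = (\<Sum>j<n. Q $$ (k, j) * of_real (x s $ j))"
          using x[of s] k Q by (simp add: z_def X_def scalar_prod_def atLeast0LessThan)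
      qed
      moreover have "(\<Sum>j<n. Q $$ (k, j) * of_real ((M *\<^sub>v x s) $ j)) = (\<Sum>j = k..<n. U $$ (k, j) * z j s)"
      proof -
        have MX: "map_vec complex_of_real (M *\<^sub>v x s) = Mc *\<^sub>v X s"
          unfolding Mc_def X_def by (rule of_real_hom.mult_mat_vec_hom[OF M x[OF s]])
        have "Q *\<^sub>v (Mc *\<^sub>v X s) = (Q * Mc) *\<^sub>v X s"
          using assoc_mult_mat_vec[OF Q Mc X[OF s]] by simp
        also have "Q * Mc = Q * (P * (U * Q))" unfolding Mc_eq assoc_mult_mat[OF P U Q] ..
        also have "\<dots> = (Q * P) * (U * Q)"
          by (rule assoc_mult_mat[OF Q P mult_carrier_mat[OF U Q], symmetric])
        also have "\<dots> = U * Q" using left_mult_one_mat[OF mult_carrier_mat[OF U Q]] by (simp only: QP)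
        also have "(U * Q) *\<^sub>v X s = U *\<^sub>v (Q *\<^sub>v X s)" by (rule assoc_mult_mat_vec[OF U Q X[OF s]])
        finally have eq: "Q *\<^sub>v map_vec complex_of_real (M *\<^sub>v x s) = U *\<^sub>v (Q *\<^sub>v X s)" unfolding MX .
        have "(\<Sum>j<n. Q $$ (k, j) * of_real ((M *\<^sub>v x s) $ j)) = (Q *\<^sub>v map_vec complex_of_real (M *\<^sub>v x s)) $ k"
          using k Q M by (simp add: scalar_prod_def atLeast0LessThan)
        also have "\<dots> = (\<Sum>j = 0..<n. U $$ (k, j) * z j s)"
          unfolding eq using k U Q by (simp add: scalar_prod_def z_def)
        also have "\<dots> = (\<Sum>j = k..<n. U $$ (k, j) * z j s)"
          using tri k U by (intro sum.mono_neutral_right) (auto simp: upper_triangular_def)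
        finally show ?thesis .
      qed
      ultimately show ?thesis by (simp only:)
    qed
    have z_decay: "l1_norm (Q *\<^sub>v X t) \<le> real n * (C * l1_norm (Q *\<^sub>v X 0) * exp (- \<rho> * t))"
    proof -
      have "l1_norm (Q *\<^sub>v X t) = (\<Sum>k<n. norm (z k t))" for t
        using Q by (simp add: l1_norm_def z_def)
      moreover have "(\<Sum>k<n. norm (z k t)) \<le> (\<Sum>k<n. C * (\<Sum>j<n. norm (z j 0)) * exp (- \<rho> * t))"
        using decay[rule_format, of z, OF z' _ t] by (intro sum_mono) (simp only: lessThan_iff)
      ultimately show ?thesis by simp
    qed
    have "X t = P *\<^sub>v (Q *\<^sub>v X t)"
      using assoc_mult_mat_vec[OF P Q X[OF t]] X[OF t] by (simp add: PQ)
    then have "euclid_norm (x t) \<le> l1_norm (P *\<^sub>v (Q *\<^sub>v X t))"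
      using euclid_norm_le_l1_norm[of "x t"] by (simp add: X_def)
    also have "\<dots> \<le> CP * l1_norm (Q *\<^sub>v X t)"
      by (intro CP(2) mult_mat_vec_carrier[OF Q X[OF t]])
    also have "\<dots> \<le> CP * (real n * (C * (CQ * (real n * euclid_norm (x 0))) * exp (- \<rho> * t)))"
    proof (rule mult_left_mono[OF order.trans[OF z_decay] CP(1)])
      have "l1_norm (X 0) \<le> real n * euclid_norm (x 0)"
        using l1_norm_le_euclid_norm[of "x 0"] x[of 0] by (simp add: X_def)
      then have "l1_norm (Q *\<^sub>v X 0) \<le> CQ * (real n * euclid_norm (x 0))"
        using order.trans[OF CQ(2)[OF X[of 0]] mult_left_mono[OF _ CQ(1)]] by simp
      then show "real n * (C * l1_norm (Q *\<^sub>v X 0) * exp (- \<rho> * t))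
          \<le> real n * (C * (CQ * (real n * euclid_norm (x 0))) * exp (- \<rho> * t))"
        using C by (intro mult_left_mono mult_right_mono) auto
    qed
    also have "\<dots> = (\<kappa> - 1) * exp (- \<rho> * t) * euclid_norm (x 0)" by (simp add: \<kappa>_def)
    also have "\<dots> \<le> \<kappa> * exp (- \<rho> * t) * euclid_norm (x 0)"
      by (intro mult_right_mono) (auto simp: euclid_norm_def real_scalar_prod_self_ge_0)
    finally show ?thesis .
  qed
  ultimately show ?thesis using \<rho>(1) unfolding globally_exp_stable_def by blast
qed

text \<open>The real and imaginary parts of \<open>exp ((a + i b) t) (x + i y)\<close>.\<close>

lemma lin_ode_solution_of_real_eigenpair:
  assumes E: "M *\<^sub>v x = a \<cdot>\<^sub>v x - b \<cdot>\<^sub>v y" "M *\<^sub>v y = b \<cdot>\<^sub>v x + a \<cdot>\<^sub>v y"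
    and M: "M \<in> carrier_mat n n" and x: "x \<in> carrier_vec n" and y: "y \<in> carrier_vec n"
  shows "lin_ode_solution M (\<lambda>t. exp (a * t) \<cdot>\<^sub>v (cos (b * t) \<cdot>\<^sub>v x - sin (b * t) \<cdot>\<^sub>v y))" (is "lin_ode_solution M ?\<xi>")
    and "lin_ode_solution M (\<lambda>t. exp (a * t) \<cdot>\<^sub>v (sin (b * t) \<cdot>\<^sub>v x + cos (b * t) \<cdot>\<^sub>v y))" (is "lin_ode_solution M ?\<eta>")
proof -
  have d: "((\<lambda>s. ?\<xi> s $ i) has_real_derivative (M *\<^sub>v ?\<xi> t) $ i) (at t within {0..})"
    "((\<lambda>s. ?\<eta> s $ i) has_real_derivative (M *\<^sub>v ?\<eta> t) $ i) (at t within {0..})" if i: "i < n" for t i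
  proof -
    have "M *\<^sub>v ?\<xi> t = exp (a * t) \<cdot>\<^sub>v (cos (b * t) \<cdot>\<^sub>v (M *\<^sub>v x) - sin (b * t) \<cdot>\<^sub>v (M *\<^sub>v y))"
      "M *\<^sub>v ?\<eta> t = exp (a * t) \<cdot>\<^sub>v (sin (b * t) \<cdot>\<^sub>v (M *\<^sub>v x) + cos (b * t) \<cdot>\<^sub>v (M *\<^sub>v y))"
      using x y by (simp_all add: mult_mat_vec[OF M] mult_minus_distrib_mat_vec[OF M] mult_add_distrib_mat_vec[OF M])
    then have "(M *\<^sub>v ?\<xi> t) $ i = exp (a * t) * (cos (b * t) * (a * x $ i - b * y $ i) - sin (b * t) * (b * x $ i + a * y $ i))"
      "(M *\<^sub>v ?\<eta> t) $ i = exp (a * t) * (sin (b * t) * (a * x $ i - b * y $ i) + cos (b * t) * (b * x $ i + a * y $ i))"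
      using i x y by (simp_all add: E)
    moreover have "(\<lambda>s. ?\<xi> s $ i) = (\<lambda>s. exp (a * s) * (cos (b * s) * x $ i - sin (b * s) * y $ i))"
      "(\<lambda>s. ?\<eta> s $ i) = (\<lambda>s. exp (a * s) * (sin (b * s) * x $ i + cos (b * s) * y $ i))"
      using i x y by auto
    ultimately show "((\<lambda>s. ?\<xi> s $ i) has_real_derivative (M *\<^sub>v ?\<xi> t) $ i) (at t within {0..})"
      "((\<lambda>s. ?\<eta> s $ i) has_real_derivative (M *\<^sub>v ?\<eta> t) $ i) (at t within {0..})"
      by (auto intro!: derivative_eq_intros simp: algebra_simps)
  qed
  show "lin_ode_solution M ?\<xi>" "lin_ode_solution M ?\<eta>"
    using d M x y unfolding lin_ode_solution_def by auto
qed

text \<open>The squared norms of the real and imaginary parts of the solution \<open>exp ((a + i b) t) (x + i y)\<close> add up to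
  \<open>exp (2 a t)\<close> times their initial value: the rotation cancels in the sum. If \<open>a \<ge> 0\<close> this sum does not
  decay, contrary to exponential stability.\<close>

lemma globally_exp_stable_imp_hurwitz:
  assumes M: "M \<in> carrier_mat n n" and ges: "globally_exp_stable M"
  shows "hurwitz M"
  unfolding hurwitz_iff_real_eigenpair[OF M]
proof (intro allI impI, rule ccontr)
  fix a b x y assume E: "real_eigenpair M a b x y" and "\<not> a < 0"
  then have a: "a \<ge> 0" by simp
  obtain \<kappa> \<rho> where \<kappa>: "\<kappa> > 0" and \<rho>: "\<rho> > 0" and bound: "\<And>x t. lin_ode_solution M x \<Longrightarrow> t \<ge> 0 \<Longrightarrow>
      euclid_norm (x t) \<le> \<kappa> * exp (- \<rho> * t) * euclid_norm (x 0)"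
    using ges unfolding globally_exp_stable_def by blast
  have x: "x \<in> carrier_vec n" and y: "y \<in> carrier_vec n" and nz: "x \<noteq> 0\<^sub>v n \<or> y \<noteq> 0\<^sub>v n"
    and eqs: "M *\<^sub>v x = a \<cdot>\<^sub>v x - b \<cdot>\<^sub>v y" "M *\<^sub>v y = b \<cdot>\<^sub>v x + a \<cdot>\<^sub>v y"
    using E M by (auto simp: real_eigenpair_def)
  let ?\<xi> = "\<lambda>t. exp (a * t) \<cdot>\<^sub>v (cos (b * t) \<cdot>\<^sub>v x - sin (b * t) \<cdot>\<^sub>v y)"
  let ?\<eta> = "\<lambda>t. exp (a * t) \<cdot>\<^sub>v (sin (b * t) \<cdot>\<^sub>v x + cos (b * t) \<cdot>\<^sub>v y)"
  note sols = lin_ode_solution_of_real_eigenpair[OF eqs M x y]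
  define E0 where "E0 = x \<bullet> x + y \<bullet> y"
  have "E0 > 0"
    using nz real_scalar_prod_self_eq_0[OF x] real_scalar_prod_self_eq_0[OF y]
      real_scalar_prod_self_ge_0[of x] real_scalar_prod_self_ge_0[of y]
    unfolding E0_def by (metis add_nonneg_eq_0_iff add_nonneg_nonneg less_eq_real_def)
  have sq: "v \<bullet> v = (euclid_norm v)\<^sup>2" for v
    by (simp add: euclid_norm_def real_scalar_prod_self_ge_0)
  have energy: "?\<xi> t \<bullet> ?\<xi> t + ?\<eta> t \<bullet> ?\<eta> t = (exp (a * t))\<^sup>2 * E0" for t
  proof -
    have "?\<xi> t \<bullet> ?\<xi> t + ?\<eta> t \<bullet> ?\<eta> t =
        (\<Sum>i<n. (?\<xi> t $ i)\<^sup>2 + (?\<eta> t $ i)\<^sup>2)"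
      using x y by (simp add: scalar_prod_def sum.distrib power2_eq_square atLeast0LessThan)
    also have "\<dots> = (\<Sum>i<n. (exp (a * t))\<^sup>2 * (x $ i * x $ i + y $ i * y $ i))"
    proof (rule sum.cong[OF refl])
      fix i assume "i \<in> {..<n}"
      then have "?\<xi> t $ i = exp (a * t) * (cos (b * t) * x $ i - sin (b * t) * y $ i)"
        "?\<eta> t $ i = exp (a * t) * (sin (b * t) * x $ i + cos (b * t) * y $ i)"
        using x y by simp_all
      moreover have "(e * (c * u - s * v))\<^sup>2 + (e * (s * u + c * v))\<^sup>2 = e\<^sup>2 * ((c\<^sup>2 + s\<^sup>2) * (u * u + v * v))"
        for e c s u v :: real
        by (simp add: power2_eq_square algebra_simps)
      ultimately have "(?\<xi> t $ i)\<^sup>2 + (?\<eta> t $ i)\<^sup>2 = (exp (a * t))\<^sup>2 *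
          (((cos (b * t))\<^sup>2 + (sin (b * t))\<^sup>2) * (x $ i * x $ i + y $ i * y $ i))"
        by (simp only:)
      then show "(?\<xi> t $ i)\<^sup>2 + (?\<eta> t $ i)\<^sup>2 = (exp (a * t))\<^sup>2 * (x $ i * x $ i + y $ i * y $ i)"
        by simp
    qed
    also have "\<dots> = (exp (a * t))\<^sup>2 * E0"
    proof -
      have "E0 = (\<Sum>i<n. x $ i * x $ i + y $ i * y $ i)"
        using x y by (simp add: E0_def scalar_prod_def sum.distrib atLeast0LessThan)
      then show ?thesis by (simp only: sum_distrib_left)
    qed
    finally show ?thesis .
  qed
  \<comment> \<open>A time at which the assumed bound has dropped to \<open>\<kappa> / (\<kappa> + 1) < 1\<close>.\<close>
  define t where "t = ln (\<kappa> + 1) / \<rho>"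
  have t: "t \<ge> 0" using \<kappa> \<rho> by (simp add: t_def)
  have small: "\<kappa> * exp (- \<rho> * t) < 1"
    using \<kappa> \<rho> by (simp add: t_def exp_minus field_simps)
  have "(euclid_norm (\<zeta> t))\<^sup>2 \<le> (\<kappa> * exp (- \<rho> * t))\<^sup>2 * (euclid_norm (\<zeta> 0))\<^sup>2"
    if "lin_ode_solution M \<zeta>" for \<zeta>
    using power_mono[OF bound[OF that t], of 2]
    by (simp add: power_mult_distrib euclid_norm_def real_scalar_prod_self_ge_0)
  from add_mono[OF this[OF sols(1)] this[OF sols(2)]]
  have "?\<xi> t \<bullet> ?\<xi> t + ?\<eta> t \<bullet> ?\<eta> t \<le> (\<kappa> * exp (- \<rho> * t))\<^sup>2 * (?\<xi> 0 \<bullet> ?\<xi> 0 + ?\<eta> 0 \<bullet> ?\<eta> 0)"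
    unfolding sq distrib_left .
  then have "(exp (a * t))\<^sup>2 * E0 \<le> (\<kappa> * exp (- \<rho> * t))\<^sup>2 * E0"
    unfolding energy by simp
  then have "(exp (a * t))\<^sup>2 \<le> (\<kappa> * exp (- \<rho> * t))\<^sup>2" using \<open>E0 > 0\<close> by simp
  then have "exp (a * t) \<le> \<kappa> * exp (- \<rho> * t)" using \<kappa> by (simp add: power2_le_iff_abs_le)
  moreover have "exp (a * t) \<ge> 1" using a t by simp
  ultimately show False using small by linarith
qed

lemma globally_exp_stable_iff_hurwitz:
  assumes "M \<in> carrier_mat n n"
  shows "globally_exp_stable M \<longleftrightarrow> hurwitz M"
  using hurwitz_imp_globally_exp_stable[OF assms] globally_exp_stable_imp_hurwitz[OF assms] by blast

section \<open>The cascades generated by the barrier functions\<close>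

lemma pow_mat_Suc_left:
  assumes A: "A \<in> carrier_mat n n"
  shows "A ^\<^sub>m Suc k = A * A ^\<^sub>m k"
proof (induction k)
  case (Suc k)
  have "A ^\<^sub>m Suc (Suc k) = A * A ^\<^sub>m k * A" using Suc by simp
  also have "\<dots> = A * (A ^\<^sub>m k * A)"
    using A pow_carrier_mat[OF A] by (intro assoc_mult_mat) auto
  finally show ?case by simp
qed (use A in simp)

lemma Phi_carrier [simp]: "A \<in> carrier_mat n n \<Longrightarrow> Phi A a j \<in> carrier_mat n n"
  by (induction j) auto

text \<open>For \<open>j\<close> below the relative degree, the columns of \<open>T\<^sub>\<psi>\<close>. They are the gradients of the functions \<open>\<psi>\<^sub>j\<close> that the HOCBF recursion
  \<open>\<psi>\<^sub>j\<^sub>+\<^sub>1 = \<psi>\<^sub>j' + \<alpha>\<^sub>j\<^sub>+\<^sub>1 \<psi>\<^sub>j\<close> generates from \<open>\<psi>\<^sub>0 = h\<close>.\<close>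

abbreviation psi_vec :: "real mat \<Rightarrow> (nat \<Rightarrow> real) \<Rightarrow> real vec \<Rightarrow> nat \<Rightarrow> real vec" where
  "psi_vec A a c j \<equiv> (Phi A a j)\<^sup>T *\<^sub>v c"

lemma psi_vec_carrier:
  "A \<in> carrier_mat n n \<Longrightarrow> psi_vec A a c j \<in> carrier_vec n"
  by (rule carrier_vecI) (simp add: carrier_matD(2)[OF Phi_carrier])

lemma psi_vec_Suc:
  assumes A: "A \<in> carrier_mat n n" and c: "c \<in> carrier_vec n"
  shows "psi_vec A a c (Suc j) = A\<^sup>T *\<^sub>v psi_vec A a c j + a (Suc j) \<cdot>\<^sub>v psi_vec A a c j"
proof -
  let ?X = "A + a (Suc j) \<cdot>\<^sub>m 1\<^sub>m (dim_row A)"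
  have X: "?X \<in> carrier_mat n n" using A by auto
  have P: "Phi A a j \<in> carrier_mat n n" using A by simp
  have "psi_vec A a c (Suc j) = ?X\<^sup>T *\<^sub>v psi_vec A a c j"
    using c X P by (simp add: transpose_mult[OF P X] assoc_mult_mat_vec[of "?X\<^sup>T" n n _ n])
  also have "?X\<^sup>T = A\<^sup>T + a (Suc j) \<cdot>\<^sub>m 1\<^sub>m n"
    using A by (intro eq_matI) auto
  also have "(A\<^sup>T + a (Suc j) \<cdot>\<^sub>m 1\<^sub>m n) *\<^sub>v psi_vec A a c j = A\<^sup>T *\<^sub>v psi_vec A a c j + (a (Suc j) \<cdot>\<^sub>m 1\<^sub>m n) *\<^sub>v psi_vec A a c j"
    using A psi_vec_carrier[OF A] by (intro add_mult_distrib_mat_vec) auto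
  also have "(a (Suc j) \<cdot>\<^sub>m 1\<^sub>m n) *\<^sub>v psi_vec A a c j = a (Suc j) \<cdot>\<^sub>v psi_vec A a c j"
    using carrier_vecD[OF psi_vec_carrier[OF A, of a j c]] psi_vec_carrier[OF A, of a j c]
    by (intro eq_vecI) (auto simp del: Phi.simps)
  finally show ?thesis .
qed

text \<open>Modulo \<open>c\<^sup>T A\<^sup>l B\<close> with \<open>l\<close> below the relative degree minus one, which all vanish, \<open>\<Phi>\<^sub>j(A)\<close> acts like \<open>A\<^sup>j\<close>.
  The exponent \<open>i\<close> is carried along because each factor of \<open>\<Phi>\<^sub>j\<close> contributes one power of \<open>A\<close>.\<close>

lemma psi_vec_input_channel:
  assumes A: "A \<in> carrier_mat n n" and B: "B \<in> carrier_mat n m" and c: "c \<in> carrier_vec n"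
    and deg: "has_relative_degree A B c k" and "i + j < k"
  shows "(A ^\<^sub>m i * B)\<^sup>T *\<^sub>v psi_vec A a c j = (A ^\<^sub>m (i + j) * B)\<^sup>T *\<^sub>v c"
  using \<open>i + j < k\<close>
proof (induction j arbitrary: i)
  case 0
  then show ?case using A c by simp
next
  case (Suc j)
  let ?f = "psi_vec A a c j"
  have f: "?f \<in> carrier_vec n" by (rule psi_vec_carrier[OF A])
  have pow: "A ^\<^sub>m l * B \<in> carrier_mat n m" for l using A B pow_carrier_mat[OF A] by auto
  have shift: "(A ^\<^sub>m i * B)\<^sup>T *\<^sub>v (A\<^sup>T *\<^sub>v ?f) = (A ^\<^sub>m Suc i * B)\<^sup>T *\<^sub>v ?f"
  proof -
    have "A ^\<^sub>m Suc i * B = A * (A ^\<^sub>m i * B)"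
      unfolding pow_mat_Suc_left[OF A] by (rule assoc_mult_mat[OF A pow_carrier_mat[OF A] B])
    then have "(A ^\<^sub>m Suc i * B)\<^sup>T = (A ^\<^sub>m i * B)\<^sup>T * A\<^sup>T"
      using transpose_mult[OF A pow] by simp
    then show ?thesis
      using assoc_mult_mat_vec[of "(A ^\<^sub>m i * B)\<^sup>T" m n "A\<^sup>T" n ?f] pow[of i] A f by simp
  qed
  have "(A ^\<^sub>m i * B)\<^sup>T *\<^sub>v psi_vec A a c (Suc j) =
      (A ^\<^sub>m i * B)\<^sup>T *\<^sub>v (A\<^sup>T *\<^sub>v ?f) + a (Suc j) \<cdot>\<^sub>v ((A ^\<^sub>m i * B)\<^sup>T *\<^sub>v ?f)"
    unfolding psi_vec_Suc[OF A c] using pow[of i] A f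
    by (simp add: mult_add_distrib_mat_vec[of _ m n] mult_mat_vec[of _ m n])
  also have "\<dots> = (A ^\<^sub>m (Suc i + j) * B)\<^sup>T *\<^sub>v c + a (Suc j) \<cdot>\<^sub>v ((A ^\<^sub>m (i + j) * B)\<^sup>T *\<^sub>v c)"
    unfolding shift using Suc.IH[of "Suc i"] Suc.IH[of i] Suc.prems by simp
  also have "(A ^\<^sub>m (i + j) * B)\<^sup>T *\<^sub>v c = 0\<^sub>v m"
    using deg Suc.prems B by (auto simp: has_relative_degree_def)
  also have "(A ^\<^sub>m (Suc i + j) * B)\<^sup>T *\<^sub>v c + a (Suc j) \<cdot>\<^sub>v 0\<^sub>v m = (A ^\<^sub>m (i + Suc j) * B)\<^sup>T *\<^sub>v c"
    using pow[of "i + Suc j"] by (intro eq_vecI) auto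
  finally show ?case .
qed

lemma ell_eq:
  assumes A: "A \<in> carrier_mat n n" and B: "B \<in> carrier_mat n m" and c: "c i \<in> carrier_vec n"
  shows "ell A B c r i = (A ^\<^sub>m (r i - 1) * B)\<^sup>T *\<^sub>v c i"
  unfolding ell_def transpose_mult[OF pow_carrier_mat[OF A] B]
  using A B c pow_carrier_mat[OF A] by (intro assoc_mult_mat_vec[symmetric]) auto

lemma psi_vec_input:
  assumes A: "A \<in> carrier_mat n n" and B: "B \<in> carrier_mat n m" and c: "c i \<in> carrier_vec n"
    and deg: "has_relative_degree A B (c i) (r i)" and j: "j < r i"
  shows "B\<^sup>T *\<^sub>v psi_vec A a (c i) j = (if Suc j = r i then ell A B c r i else 0\<^sub>v m)"
proof -
  have "B\<^sup>T *\<^sub>v psi_vec A a (c i) j = (A ^\<^sub>m j * B)\<^sup>T *\<^sub>v c i"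
    using psi_vec_input_channel[OF A B c deg, of 0 j a] j A B by simp
  moreover have "(A ^\<^sub>m j * B)\<^sup>T *\<^sub>v c i = 0\<^sub>v m" if "Suc j \<noteq> r i"
    using deg j that B by (auto simp: has_relative_degree_def)
  moreover have "(A ^\<^sub>m j * B)\<^sup>T *\<^sub>v c i = ell A B c r i" if "Suc j = r i"
    unfolding ell_eq[where c = c and i = i, OF A B c] that[symmetric] by simp
  ultimately show ?thesis by simp
qed

text \<open>A gain with \<open>\<ell>\<^sup>T K = c\<^sup>T \<Phi>\<^sub>r(A)\<close> cancels exactly the term by which the chain would continue past its
  end, where the input enters. Along the closed loop the linear parts of the \<open>\<psi>\<^sub>j\<close> therefore form a cascade
  of scalar systems with the poles \<open>- \<alpha>\<^sub>j\<close>, whatever else the gain does.\<close>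

lemma psi_vec_closed_loop:
  assumes A: "A \<in> carrier_mat n n" and B: "B \<in> carrier_mat n m" and c: "c i \<in> carrier_vec n"
    and deg: "has_relative_degree A B (c i) (r i)" and j: "j < r i"
    and K: "K \<in> carrier_mat m n" and gain: "K\<^sup>T *\<^sub>v ell A B c r i = cPhi A c r \<alpha> i"
  shows "(A - B * K)\<^sup>T *\<^sub>v psi_vec A (\<alpha> i) (c i) j =
    (if Suc j < r i then psi_vec A (\<alpha> i) (c i) (Suc j) else 0\<^sub>v n) - \<alpha> i (Suc j) \<cdot>\<^sub>v psi_vec A (\<alpha> i) (c i) j"
proof -
  let ?f = "psi_vec A (\<alpha> i) (c i)"
  have f: "?f j \<in> carrier_vec n" for j by (rule psi_vec_carrier[OF A])
  have "(A - B * K)\<^sup>T = A\<^sup>T - K\<^sup>T * B\<^sup>T"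
    unfolding transpose_minus[OF A mult_carrier_mat[OF B K]] transpose_mult[OF B K] ..
  then have "(A - B * K)\<^sup>T *\<^sub>v ?f j = A\<^sup>T *\<^sub>v ?f j - K\<^sup>T *\<^sub>v (B\<^sup>T *\<^sub>v ?f j)"
    using A B K f minus_mult_distrib_mat_vec[of "A\<^sup>T" n n "K\<^sup>T * B\<^sup>T" "?f j"]
      assoc_mult_mat_vec[of "K\<^sup>T" n m "B\<^sup>T" n "?f j"] by simp
  moreover have "A\<^sup>T *\<^sub>v ?f j = ?f (Suc j) - \<alpha> i (Suc j) \<cdot>\<^sub>v ?f j"
    unfolding psi_vec_Suc[OF A c]
    using f A carrier_matD(2)[OF Phi_carrier[OF A]] by (intro eq_vecI) (auto simp del: Phi.simps)
  moreover have "K\<^sup>T *\<^sub>v (B\<^sup>T *\<^sub>v ?f j) = (if Suc j < r i then 0\<^sub>v n else ?f (Suc j))"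
  proof (cases "Suc j = r i")
    case True
    then show ?thesis using psi_vec_input[where c = c and i = i and r = r and a = "\<alpha> i", OF A B c deg j] gain by (simp add: cPhi_def del: Phi.simps)
  next
    case False
    have "K\<^sup>T *\<^sub>v 0\<^sub>v m = 0\<^sub>v n" using K by (intro eq_vecI) auto
    with False show ?thesis using psi_vec_input[where c = c and i = i and r = r and a = "\<alpha> i", OF A B c deg j] j by (simp del: Phi.simps)
  qed
  ultimately show ?thesis
    using f[of j] f[of "Suc j"] A carrier_matD(2)[OF Phi_carrier[OF A]]
    by (intro eq_vecI) (auto simp del: Phi.simps)
qed

text \<open>Pairing the last functional of the cascade with an eigenvector \<open>v\<close> of eigenvalue \<open>\<mu>\<close> gives
  \<open>(\<mu> + s\<^sub>k) (f \<bullet> v) = 0\<close>, and \<open>\<mu> + s\<^sub>k \<noteq> 0\<close> if \<open>Re \<mu> \<ge> 0\<close>; the earlier functionals follow in turn.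
  Hence the unstable eigenvectors lie in the joint kernel of the cascade.\<close>

lemma real_eigenpair_annihilates_decaying_chain:
  assumes N: "N \<in> carrier_mat n n" and f: "\<And>j. f j \<in> carrier_vec n"
    and shift: "\<And>j. j < k \<Longrightarrow> N\<^sup>T *\<^sub>v f j = (if Suc j < k then f (Suc j) else 0\<^sub>v n) - s (Suc j) \<cdot>\<^sub>v f j"
    and s: "\<And>j. j \<in> {1..k} \<Longrightarrow> s j > 0"
    and E: "real_eigenpair N a b x y" and a: "a \<ge> 0"
    and "j < k"
  shows "f j \<bullet> x = 0 \<and> f j \<bullet> y = 0"
  using \<open>j < k\<close>
proof (induction "k - j" arbitrary: j rule: less_induct)
  case less
  have x: "x \<in> carrier_vec n" and y: "y \<in> carrier_vec n"
    and eqs: "N *\<^sub>v x = a \<cdot>\<^sub>v x - b \<cdot>\<^sub>v y" "N *\<^sub>v y = b \<cdot>\<^sub>v x + a \<cdot>\<^sub>v y"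
    using E N by (auto simp: real_eigenpair_def)
  define X Y where "X = f j \<bullet> x" and "Y = f j \<bullet> y"
  have next_zero: "f (Suc j) \<bullet> x = 0 \<and> f (Suc j) \<bullet> y = 0" if "Suc j < k"
    using less.hyps[of "Suc j"] that by simp
  have dual: "f j \<bullet> (N *\<^sub>v w) = - s (Suc j) * (f j \<bullet> w)"
    if w: "w \<in> carrier_vec n" and "Suc j < k \<Longrightarrow> f (Suc j) \<bullet> w = 0" for w
  proof -
    have "f j \<bullet> (N *\<^sub>v w) = (N\<^sup>T *\<^sub>v f j) \<bullet> w"
      using transpose_vec_mult_scalar[OF N w f] by simp
    also have "\<dots> = (if Suc j < k then f (Suc j) else 0\<^sub>v n) \<bullet> w - (s (Suc j) \<cdot>\<^sub>v f j) \<bullet> w"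
      unfolding shift[OF less.prems] using f w by (intro minus_scalar_prod_distrib) auto
    also have "\<dots> = - s (Suc j) * (f j \<bullet> w)"
      using that f by (simp add: carrier_vecD[OF f] carrier_vecD[OF w])
    finally show ?thesis .
  qed
  have "a * X - b * Y = - s (Suc j) * X" "b * X + a * Y = - s (Suc j) * Y"
  proof -
    have "f j \<bullet> (N *\<^sub>v x) = a * X - b * Y" unfolding eqs X_def Y_def
      using f[of j] x y by (simp add: scalar_prod_minus_distrib[of _ n] carrier_vecD[OF f] carrier_vecD[OF x] carrier_vecD[OF y])
    moreover have "f j \<bullet> (N *\<^sub>v y) = b * X + a * Y" unfolding eqs X_def Y_def
      using f[of j] x y by (simp add: scalar_prod_add_distrib[of _ n] carrier_vecD[OF f] carrier_vecD[OF x] carrier_vecD[OF y])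
    ultimately show "a * X - b * Y = - s (Suc j) * X" "b * X + a * Y = - s (Suc j) * Y"
      using dual[OF x] dual[OF y] next_zero by (simp_all add: X_def Y_def)
  qed
  then have "(a + s (Suc j)) * X = b * Y" "(a + s (Suc j)) * Y = - (b * X)"
    by (simp_all add: algebra_simps)
  \<comment> \<open>The terms with \<open>b\<close> cancel.\<close>
  then have "(a + s (Suc j)) * (X * X + Y * Y) = 0"
    by (simp add: distrib_left flip: mult.assoc)
  moreover have "a + s (Suc j) > 0" using a s[of "Suc j"] less.prems by simp
  ultimately have "X * X + Y * Y = 0" by simp
  then show ?case by (simp add: X_def Y_def)
qed

lemma mat_of_cols_transpose_mult_eq_0_iff:
  fixes x :: "real vec"
  assumes vs: "set vs \<subseteq> carrier_vec n" and x: "x \<in> carrier_vec n"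
  shows "(mat_of_cols n vs)\<^sup>T *\<^sub>v x = 0\<^sub>v (length vs) \<longleftrightarrow> (\<forall>v \<in> set vs. v \<bullet> x = 0)"
proof -
  have "((mat_of_cols n vs)\<^sup>T *\<^sub>v x) $ i = vs ! i \<bullet> x" if "i < length vs" for i
    using that vs by (simp add: subsetD)
  then have "(mat_of_cols n vs)\<^sup>T *\<^sub>v x = 0\<^sub>v (length vs) \<longleftrightarrow> (\<forall>i < length vs. vs ! i \<bullet> x = 0)"
    by (auto simp: vec_eq_iff)
  also have "\<dots> \<longleftrightarrow> (\<forall>v \<in> set vs. v \<bullet> x = 0)" by (auto simp: all_set_conv_all_nth)
  finally show ?thesis .
qed

lemma mat_kernel_T_psi:
  assumes A: "A \<in> carrier_mat n n"
  shows "mat_kernel ((T_psi A c r \<alpha> p)\<^sup>T) =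
    {x \<in> carrier_vec n. \<forall>i \<in> {1..p}. \<forall>j < r i. psi_vec A (\<alpha> i) (c i) j \<bullet> x = 0}"
proof -
  define vs where "vs = concat (map (\<lambda>i. map (\<lambda>j. psi_vec A (\<alpha> i) (c i) j) [0..<r i]) [1..<Suc p])"
  have T: "T_psi A c r \<alpha> p = mat_of_cols n vs" using A by (simp add: T_psi_def vs_def)
  have set_vs: "set vs = (\<Union>i \<in> {1..p}. psi_vec A (\<alpha> i) (c i) ` {..<r i})"
    by (simp add: vs_def atLeastLessThanSuc_atLeastAtMost atLeast0LessThan del: upt_Suc)
  then have vs: "set vs \<subseteq> carrier_vec n" using psi_vec_carrier[OF A] by auto
  have "mat_kernel ((T_psi A c r \<alpha> p)\<^sup>T) = {x \<in> carrier_vec n. (mat_of_cols n vs)\<^sup>T *\<^sub>v x = 0\<^sub>v (length vs)}"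
    unfolding T mat_kernel_def by simp
  also have "\<dots> = {x \<in> carrier_vec n. \<forall>v \<in> set vs. v \<bullet> x = 0}"
    using mat_of_cols_transpose_mult_eq_0_iff[OF vs] by blast
  also have "\<dots> = {x \<in> carrier_vec n. \<forall>i \<in> {1..p}. \<forall>j < r i. psi_vec A (\<alpha> i) (c i) j \<bullet> x = 0}"
    unfolding set_vs by blast
  finally show ?thesis .
qed

section \<open>Gains that satisfy the constraints\<close>

text \<open>An affine function that is bounded below on the whole space is constant.\<close>

lemma affine_nonneg_iff:
  fixes v :: "real vec"
  assumes v: "v \<in> carrier_vec n"
  shows "(\<forall>x \<in> carrier_vec n. v \<bullet> x + b \<ge> 0) \<longleftrightarrow> v = 0\<^sub>v n \<and> b \<ge> 0"
proof
  assume nonneg: "\<forall>x \<in> carrier_vec n. v \<bullet> x + b \<ge> 0"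
  have b: "b \<ge> 0" using nonneg[rule_format, of "0\<^sub>v n"] v by simp
  have "v = 0\<^sub>v n"
  proof (rule ccontr)
    assume "v \<noteq> 0\<^sub>v n"
    then have pos: "v \<bullet> v > 0"
      using real_scalar_prod_self_eq_0[OF v] real_scalar_prod_self_ge_0[of v] by fastforce
    have "v \<bullet> (- ((b + 1) / (v \<bullet> v)) \<cdot>\<^sub>v v) + b \<ge> 0"
      using nonneg v by (metis smult_carrier_vec)
    then show False using pos by simp
  qed
  with b show "v = 0\<^sub>v n \<and> b \<ge> 0" by simp
qed auto

text \<open>Under linear feedback the left-hand side of the constraint is affine in the state, so requiring it at
  every state forces the linear part to vanish.\<close>

lemma hocbf_constraint_all_states_iff:
  assumes A: "A \<in> carrier_mat n n" and B: "B \<in> carrier_mat n m" and c: "c i \<in> carrier_vec n"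
    and K: "K \<in> carrier_mat m n" and \<alpha>: "(\<Prod>j = 1..r i. \<alpha> i j) > 0"
  shows "(\<forall>x \<in> carrier_vec n. hocbf_constraint A B c d r \<alpha> i x (- (K *\<^sub>v x))) \<longleftrightarrow>
    K\<^sup>T *\<^sub>v ell A B c r i = cPhi A c r \<alpha> i \<and> d i \<ge> 0"
proof -
  let ?e = "cPhi A c r \<alpha> i" and ?l = "ell A B c r i"
  have P: "Phi A (\<alpha> i) (r i) \<in> carrier_mat n n" using A by simp
  have e: "?e \<in> carrier_vec n" unfolding cPhi_def by (rule psi_vec_carrier[OF A])
  have l: "?l \<in> carrier_vec m" using B by (intro carrier_vecI) (simp add: ell_def)
  have Kl: "K\<^sup>T *\<^sub>v ?l \<in> carrier_vec n" using K l by simp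
  have AB: "A ^\<^sub>m (r i - 1) * B \<in> carrier_mat n m" by (rule mult_carrier_mat[OF pow_carrier_mat[OF A] B])
  have "hocbf_constraint A B c d r \<alpha> i x (- (K *\<^sub>v x)) \<longleftrightarrow>
      (?e - K\<^sup>T *\<^sub>v ?l) \<bullet> x + (\<Prod>j = 1..r i. \<alpha> i j) * d i \<ge> 0" if x: "x \<in> carrier_vec n" for x
  proof -
    have Kx: "K *\<^sub>v x \<in> carrier_vec m" using K x by simp
    have "c i \<bullet> (Phi A (\<alpha> i) (r i) *\<^sub>v x) = ?e \<bullet> x"
      unfolding cPhi_def using transpose_vec_mult_scalar[OF P x c] by simp
    moreover have "c i \<bullet> (A ^\<^sub>m (r i - 1) * B *\<^sub>v (- (K *\<^sub>v x))) = ?l \<bullet> (- (K *\<^sub>v x))"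
      unfolding ell_eq[where c = c and i = i, OF A B c] using transpose_vec_mult_scalar[OF AB _ c, of "- (K *\<^sub>v x)"] Kx by simp
    moreover have "?l \<bullet> (- (K *\<^sub>v x)) = - ((K\<^sup>T *\<^sub>v ?l) \<bullet> x)"
    proof -
      have "dim_vec ?l = dim_vec (K *\<^sub>v x)" using carrier_vecD[OF l] carrier_vecD[OF Kx] by simp
      then have "?l \<bullet> (- (K *\<^sub>v x)) = - (?l \<bullet> (K *\<^sub>v x))" by (rule scalar_prod_uminus_right)
      then show ?thesis using transpose_vec_mult_scalar[OF K x l] by simp
    qed
    ultimately show ?thesis
      by (simp add: hocbf_constraint_def minus_scalar_prod_distrib[OF e Kl x])
  qed
  then have "(\<forall>x \<in> carrier_vec n. hocbf_constraint A B c d r \<alpha> i x (- (K *\<^sub>v x))) \<longleftrightarrow>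
      ?e - K\<^sup>T *\<^sub>v ?l = 0\<^sub>v n \<and> (\<Prod>j = 1..r i. \<alpha> i j) * d i \<ge> 0"
    using affine_nonneg_iff[of "?e - K\<^sup>T *\<^sub>v ?l" n] e Kl by simp
  also have "?e - K\<^sup>T *\<^sub>v ?l = 0\<^sub>v n \<longleftrightarrow> K\<^sup>T *\<^sub>v ?l = ?e"
    using e Kl by (auto simp: vec_eq_iff)
  finally show ?thesis using \<alpha> by (simp add: zero_le_mult_iff)
qed

lemma L_mat_carrier:
  "B \<in> carrier_mat n m \<Longrightarrow> L_mat A B c r p \<in> carrier_mat m p"
  by (intro carrier_matI) (simp_all add: L_mat_def del: upt_Suc)

lemma ell_carrier: "B \<in> carrier_mat n m \<Longrightarrow> ell A B c r i \<in> carrier_vec m"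
  by (intro carrier_vecI) (simp add: ell_def)

lemma cols_L_mat:
  assumes "B \<in> carrier_mat n m"
  shows "cols (L_mat A B c r p) = map (ell A B c r) [1..<Suc p]"
  using assms ell_carrier[OF assms] unfolding L_mat_def by (subst cols_mat_of_cols) auto

lemma col_L_mat:
  assumes "B \<in> carrier_mat n m" "i < p"
  shows "col (L_mat A B c r p) i = ell A B c r (Suc i)"
  using cols_nth[of i "L_mat A B c r p"] L_mat_carrier[OF assms(1), of A c r p] assms(2)
  by (simp add: cols_L_mat[OF assms(1)] del: upt_Suc)

lemma L_mat_injective:
  assumes B: "B \<in> carrier_mat n m" and indpt: "lin_indpt_family m (ell A B c r) {1..p}"
    and v: "v \<in> carrier_vec p" and "L_mat A B c r p *\<^sub>v v = 0\<^sub>v m"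
  shows "v = 0\<^sub>v p"
proof (rule lin_indpt_family_cols_imp_injective[OF L_mat_carrier[OF B] _ v assms(4)])
  have eq: "col (L_mat A B c r p) i = (ell A B c r \<circ> Suc) i" if "i \<in> {0..<p}" for i
    using col_L_mat[OF B] that by simp
  have im: "Suc ` {0..<p} = {1..p}" by auto
  have "inj_on (ell A B c r \<circ> Suc) {0..<p}"
    using indpt im by (intro comp_inj_on) (auto simp: lin_indpt_family_def)
  moreover have "(ell A B c r \<circ> Suc) ` {0..<p} = ell A B c r ` {1..p}"
    unfolding image_comp[symmetric] im ..
  moreover have "col (L_mat A B c r p) ` {0..<p} = (ell A B c r \<circ> Suc) ` {0..<p}"
    by (rule image_cong[OF refl eq])
  moreover have "inj_on (col (L_mat A B c r p)) {0..<p} \<longleftrightarrow> inj_on (ell A B c r \<circ> Suc) {0..<p}"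
    by (rule inj_on_cong[OF eq])
  ultimately show "lin_indpt_family m (col (L_mat A B c r p)) {0..<p}"
    using indpt by (simp only: lin_indpt_family_def simp_thms)
qed

lemma real_span_ell:
  assumes B: "B \<in> carrier_mat n m"
  shows "real_span m (ell A B c r ` {1..p}) = (\<lambda>w. L_mat A B c r p *\<^sub>v w) ` carrier_vec p"
proof -
  have "set (cols (L_mat A B c r p)) = ell A B c r ` {1..p}"
    unfolding cols_L_mat[OF B] by (simp add: atLeastLessThanSuc_atLeastAtMost del: upt_Suc)
  then show ?thesis using real_span_cols_eq_range[OF L_mat_carrier[OF B], of A c r p] by simp
qed

lemma C_tilde_carrier: "A \<in> carrier_mat n n \<Longrightarrow> C_tilde A c r \<alpha> p \<in> carrier_mat p n"
  by (intro carrier_matI) (simp_all add: C_tilde_def del: upt_Suc)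

lemma L_mat_gain_iff:
  assumes A: "A \<in> carrier_mat n n" and B: "B \<in> carrier_mat n m" and K: "K \<in> carrier_mat m n"
  shows "(L_mat A B c r p)\<^sup>T * K = C_tilde A c r \<alpha> p \<longleftrightarrow>
    (\<forall>i \<in> {1..p}. K\<^sup>T *\<^sub>v ell A B c r i = cPhi A c r \<alpha> i)"
proof -
  let ?L = "L_mat A B c r p"
  have L: "?L \<in> carrier_mat m p" by (rule L_mat_carrier[OF B])
  have e: "cPhi A c r \<alpha> i \<in> carrier_vec n" for i unfolding cPhi_def by (rule psi_vec_carrier[OF A])
  have lhs: "(?L\<^sup>T * K) $$ (i, j) = (K\<^sup>T *\<^sub>v ell A B c r (Suc i)) $ j" if "i < p" "j < n" for i j
    using that L K ell_carrier[OF B, of A c r "Suc i"]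
    by (simp add: col_L_mat[OF B] comm_scalar_prod[of _ m])
  have rhs: "C_tilde A c r \<alpha> p $$ (i, j) = cPhi A c r \<alpha> (Suc i) $ j" if "i < p" "j < n" for i j
    using that A by (simp add: C_tilde_def mat_of_rows_def del: upt_Suc)
  have "?L\<^sup>T * K = C_tilde A c r \<alpha> p \<longleftrightarrow>
      (\<forall>i<p. \<forall>j<n. (K\<^sup>T *\<^sub>v ell A B c r (Suc i)) $ j = cPhi A c r \<alpha> (Suc i) $ j)"
    using L K C_tilde_carrier[OF A, of c r \<alpha> p] lhs rhs by (auto simp: mat_eq_iff)
  also have "\<dots> \<longleftrightarrow> (\<forall>i<p. K\<^sup>T *\<^sub>v ell A B c r (Suc i) = cPhi A c r \<alpha> (Suc i))"
    using K carrier_vecD[OF e] by (auto simp: vec_eq_iff)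
  also have "\<dots> \<longleftrightarrow> (\<forall>i \<in> {1..p}. K\<^sup>T *\<^sub>v ell A B c r i = cPhi A c r \<alpha> i)"
    by (metis One_nat_def Suc_le_eq Suc_pred atLeastAtMost_iff le_SucI not_less_eq_eq zero_less_Suc)
  finally show ?thesis .
qed

lemma K_zero_gain:
  assumes A: "A \<in> carrier_mat n n" and B: "B \<in> carrier_mat n m"
    and indpt: "lin_indpt_family m (ell A B c r) {1..p}"
  shows "K_zero A B c r \<alpha> p \<in> carrier_mat m n"
    and "(L_mat A B c r p)\<^sup>T * K_zero A B c r \<alpha> p = C_tilde A c r \<alpha> p"
proof -
  let ?L = "L_mat A B c r p" and ?C = "C_tilde A c r \<alpha> p"
  let ?J = "inv_mat (?L\<^sup>T * ?L)"
  have L: "?L \<in> carrier_mat m p" by (rule L_mat_carrier[OF B])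
  have Lt: "?L\<^sup>T \<in> carrier_mat p m" using L by simp
  have C: "?C \<in> carrier_mat p n" by (rule C_tilde_carrier[OF A])
  note gram = inv_mat_gram[OF L L_mat_injective[OF B indpt]]
  have LJ: "?L * ?J \<in> carrier_mat m p" by (rule mult_carrier_mat[OF L gram(1)])
  show "K_zero A B c r \<alpha> p \<in> carrier_mat m n"
    unfolding K_zero_def by (rule mult_carrier_mat[OF LJ C])
  have "?L\<^sup>T * (?L * ?J * ?C) = ?L\<^sup>T * (?L * ?J) * ?C"
    by (rule assoc_mult_mat[OF Lt LJ C, symmetric])
  also have "?L\<^sup>T * (?L * ?J) = ?L\<^sup>T * ?L * ?J"
    by (rule assoc_mult_mat[OF Lt L gram(1), symmetric])
  also have "?L\<^sup>T * ?L * ?J * ?C = ?C" using gram(2) left_mult_one_mat[OF C] by (simp only:)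
  finally show "?L\<^sup>T * K_zero A B c r \<alpha> p = ?C" unfolding K_zero_def .
qed

lemma is_basis_mat_imp_range:
  assumes "is_basis_mat n k M W"
  shows "M \<in> carrier_mat n k" and "(\<lambda>w. M *\<^sub>v w) ` carrier_vec k = W"
    and "v \<in> carrier_vec k \<Longrightarrow> M *\<^sub>v v = 0\<^sub>v n \<Longrightarrow> v = 0\<^sub>v k"
  using assms real_span_cols_eq_range[of M n k] lin_indpt_family_cols_imp_injective[of M n k v]
  by (auto simp: is_basis_mat_def)

lemma particular_plus_kernel_solutions:
  fixes L K K\<^sub>0 M :: "real mat"
  assumes L: "L \<in> carrier_mat m p" and K: "K \<in> carrier_mat m n" and K0: "K\<^sub>0 \<in> carrier_mat m n"
    and M: "M \<in> carrier_mat m q" and range: "(\<lambda>w. M *\<^sub>v w) ` carrier_vec q = mat_kernel (L\<^sup>T)"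
  shows "L\<^sup>T * K = L\<^sup>T * K\<^sub>0 \<longleftrightarrow> (\<exists>K' \<in> carrier_mat q n. K = K\<^sub>0 + M * K')"
proof
  have Lt: "L\<^sup>T \<in> carrier_mat p m" using L by simp
  assume eq: "L\<^sup>T * K = L\<^sup>T * K\<^sub>0"
  have KK: "K - K\<^sub>0 \<in> carrier_mat m n" by (rule minus_carrier_mat[OF K0])
  have "L\<^sup>T * (K - K\<^sub>0) = L\<^sup>T * K - L\<^sup>T * K\<^sub>0" by (rule mult_minus_distrib_mat[OF Lt K K0])
  also have "\<dots> = 0\<^sub>m p n" unfolding eq using L K0 by (intro minus_r_inv_mat) auto
  finally have zero: "L\<^sup>T * (K - K\<^sub>0) = 0\<^sub>m p n" .
  have "col (K - K\<^sub>0) j \<in> (\<lambda>w. M *\<^sub>v w) ` carrier_vec q" if j: "j < n" for j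
    unfolding range
  proof (rule mat_kernelI[OF Lt])
    show "col (K - K\<^sub>0) j \<in> carrier_vec m" using KK by (metis carrier_matD(1) col_dim)
    show "L\<^sup>T *\<^sub>v col (K - K\<^sub>0) j = 0\<^sub>v p"
      unfolding col_mult2[OF Lt KK j, symmetric] zero using j by simp
  qed
  from factor_through_range[OF KK M this] obtain K' where K': "K' \<in> carrier_mat q n" "K - K\<^sub>0 = M * K'"
    by blast
  have "K = K\<^sub>0 + (K - K\<^sub>0)" using K K0 by (intro eq_matI) auto
  with K' show "\<exists>K' \<in> carrier_mat q n. K = K\<^sub>0 + M * K'" by auto
next
  have Lt: "L\<^sup>T \<in> carrier_mat p m" using L by simp
  assume "\<exists>K' \<in> carrier_mat q n. K = K\<^sub>0 + M * K'"
  then obtain K' where K': "K' \<in> carrier_mat q n" and K_eq: "K = K\<^sub>0 + M * K'" by blast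
  have "L\<^sup>T * (M * K') = 0\<^sub>m p n"
  proof (rule mat_eqI_mult_vec)
    fix v :: "real vec" assume v: "v \<in> carrier_vec n"
    have "M *\<^sub>v (K' *\<^sub>v v) \<in> mat_kernel (L\<^sup>T)"
      unfolding range[symmetric] by (rule imageI[OF mult_mat_vec_carrier[OF K' v]])
    then have "L\<^sup>T *\<^sub>v (M *\<^sub>v (K' *\<^sub>v v)) = 0\<^sub>v p" by (rule mat_kernelD(2)[OF Lt])
    moreover have "(L\<^sup>T * (M * K')) *\<^sub>v v = L\<^sup>T *\<^sub>v (M *\<^sub>v (K' *\<^sub>v v))"
      by (simp only: assoc_mult_mat_vec[OF Lt mult_carrier_mat[OF M K'] v] assoc_mult_mat_vec[OF M K' v])
    moreover have "0\<^sub>m p n *\<^sub>v v = (0\<^sub>v p :: real vec)" using v by (intro eq_vecI) auto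
    ultimately show "(L\<^sup>T * (M * K')) *\<^sub>v v = 0\<^sub>m p n *\<^sub>v v" by simp
  qed (use L M K' in auto)
  then show "L\<^sup>T * K = L\<^sup>T * K\<^sub>0"
    unfolding K_eq mult_add_distrib_mat[OF Lt K0 mult_carrier_mat[OF M K']]
    using L K0 by simp
qed

text \<open>The value of \<open>K\<^sup>T\<close> on a combination of the columns of \<open>L\<close> depends only on \<open>L\<^sup>T K\<close>. So for a constraint whose
  \<open>\<ell>\<^sub>i\<close> depends linearly on the others, it suffices to test the gain \<open>K\<^sub>0\<close>.\<close>

lemma gains_agree_on_span:
  fixes K K\<^sub>0 L :: "real mat"
  assumes L: "L \<in> carrier_mat m p" and K: "K \<in> carrier_mat m n" and K0: "K\<^sub>0 \<in> carrier_mat m n"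
    and eq: "L\<^sup>T * K = L\<^sup>T * K\<^sub>0" and w: "w \<in> carrier_vec p"
  shows "K\<^sup>T *\<^sub>v (L *\<^sub>v w) = K\<^sub>0\<^sup>T *\<^sub>v (L *\<^sub>v w)"
proof -
  have "X\<^sup>T *\<^sub>v (L *\<^sub>v w) = (L\<^sup>T * X)\<^sup>T *\<^sub>v w" if X: "X \<in> carrier_mat m n" for X :: "real mat"
  proof -
    have "(L\<^sup>T * X)\<^sup>T = X\<^sup>T * L" using L X by (simp add: transpose_mult[of _ p m _ n])
    moreover have "(X\<^sup>T * L) *\<^sub>v w = X\<^sup>T *\<^sub>v (L *\<^sub>v w)" using L X w by (intro assoc_mult_mat_vec) auto
    ultimately show ?thesis by simp
  qed
  then show ?thesis using K K0 eq by simp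
qed

lemma closed_loop_split:
  fixes A B K\<^sub>0 M H :: "real mat"
  assumes A: "A \<in> carrier_mat n n" and B: "B \<in> carrier_mat n m" and K0: "K\<^sub>0 \<in> carrier_mat m n"
    and M: "M \<in> carrier_mat m q" and H: "H \<in> carrier_mat q n"
  shows "A - B * (K\<^sub>0 + M * H) = A - B * K\<^sub>0 - B * M * H"
proof -
  have "B * (K\<^sub>0 + M * H) = B * K\<^sub>0 + B * M * H"
    unfolding mult_add_distrib_mat[OF B K0 mult_carrier_mat[OF M H]] assoc_mult_mat[OF B M H] ..
  then show ?thesis using A B K0 M H by (intro eq_matI) auto
qed

section \<open>Safe stabilizing gains\<close>

theorem theorem5:
  fixes A B L_perp T\<^sub>\<eta> :: "real mat"
    and c :: "nat \<Rightarrow> real vec" and d :: "nat \<Rightarrow> real"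
    and r :: "nat \<Rightarrow> nat" and \<alpha> :: "nat \<Rightarrow> nat \<Rightarrow> real"
    and n m p pbar :: nat
  assumes "A \<in> carrier_mat n n"
    and "B \<in> carrier_mat n m"
    and "\<And>i. i \<in> {1..pbar} \<Longrightarrow> c i \<in> carrier_vec n"
    and "\<And>i. i \<in> {1..pbar} \<Longrightarrow> has_relative_degree A B (c i) (r i)"
    and "\<And>i j. i \<in> {1..pbar} \<Longrightarrow> j \<in> {1..r i} \<Longrightarrow> \<alpha> i j > 0"
    and "p \<le> pbar"
    and "lin_indpt_family m (ell A B c r) {1..p}"
    and "\<And>i. i \<in> {p+1..pbar} \<Longrightarrow> ell A B c r i \<in> real_span m (ell A B c r ` {1..p})"
    and "is_basis_mat m (m - p) L_perp (mat_kernel (transpose_mat (L_mat A B c r p)))"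
    and "is_basis_mat n (n - (\<Sum>i = 1..p. r i)) T\<^sub>\<eta> (mat_kernel (transpose_mat (T_psi A c r \<alpha> p)))"
  shows
    "((\<exists>K. safe_stabilizing_gain A B c d r \<alpha> pbar K) \<longleftrightarrow>
        (\<forall>i \<in> {1..pbar}. d i \<ge> 0) \<and>
        (\<forall>i \<in> {1..pbar} - {1..p}.
           cPhi A c r \<alpha> i - transpose_mat (K_zero A B c r \<alpha> p) *\<^sub>v ell A B c r i = 0\<^sub>v n) \<and>
        stabilizable (Gamma_eta A B c r \<alpha> p T\<^sub>\<eta>) (transpose_mat T\<^sub>\<eta> * B * L_perp)) \<and>
     (stabilizable (Gamma_eta A B c r \<alpha> p T\<^sub>\<eta>) (transpose_mat T\<^sub>\<eta> * B * L_perp) \<longleftrightarrow>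
        stabilizable (A - B * K_zero A B c r \<alpha> p) (B * L_perp)) \<and>
     ((\<exists>K. safe_stabilizing_gain A B c d r \<alpha> pbar K) \<longrightarrow>
        {K. safe_stabilizing_gain A B c d r \<alpha> pbar K} =
        {K \<in> carrier_mat m n.
           (\<exists>K' \<in> carrier_mat (m - p) n. K = K_zero A B c r \<alpha> p + L_perp * K') \<and>
           hurwitz (A - B * K)})"
proof -
  note A = assms(1) and B = assms(2) and c = assms(3) and deg = assms(4) and \<alpha> = assms(5)
    and p = assms(6) and indpt = assms(7) and dep = assms(8)
  let ?L = "L_mat A B c r p" and ?K\<^sub>0 = "K_zero A B c r \<alpha> p"
  let ?l = "ell A B c r" and ?e = "cPhi A c r \<alpha>" and ?f = "\<lambda>i. psi_vec A (\<alpha> i) (c i)"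
  let ?k = "n - (\<Sum>i = 1..p. r i)" and ?W = "mat_kernel ((T_psi A c r \<alpha> p)\<^sup>T)"
  note L = L_mat_carrier[OF B, of A c r p]
  note K0 = K_zero_gain[OF A B indpt, of \<alpha>]
  note Lp = is_basis_mat_imp_range(1,2)[OF assms(9)]
  note T = is_basis_mat_imp_range[OF assms(10)]
  have e: "?e i \<in> carrier_vec n" for i unfolding cPhi_def by (rule psi_vec_carrier[OF A])

  have param: "(\<forall>i \<in> {1..p}. K\<^sup>T *\<^sub>v ?l i = ?e i) \<longleftrightarrow>
      (\<exists>K' \<in> carrier_mat (m - p) n. K = ?K\<^sub>0 + L_perp * K')" if K: "K \<in> carrier_mat m n" for K
    using L_mat_gain_iff[OF A B K, of c r p \<alpha>] K0(2)
      particular_plus_kernel_solutions[OF L K K0(1) Lp] by simp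
  have dependent: "K\<^sup>T *\<^sub>v ?l i = ?K\<^sub>0\<^sup>T *\<^sub>v ?l i"
    if K: "K \<in> carrier_mat m n" and gain: "\<forall>i \<in> {1..p}. K\<^sup>T *\<^sub>v ?l i = ?e i" and i: "i \<in> {1..pbar} - {1..p}"
    for K i
  proof -
    obtain w where w: "w \<in> carrier_vec p" "?l i = ?L *\<^sub>v w"
      using dep[of i] i unfolding real_span_ell[OF B] by auto
    have "?L\<^sup>T * K = ?L\<^sup>T * ?K\<^sub>0"
      using L_mat_gain_iff[OF A B K, of c r p \<alpha>] gain K0(2) by simp
    from gains_agree_on_span[OF L K K0(1) this w(1)] show ?thesis by (simp only: w(2))
  qed
  have redundancy: "?e i - ?K\<^sub>0\<^sup>T *\<^sub>v ?l i = 0\<^sub>v n \<longleftrightarrow> ?K\<^sub>0\<^sup>T *\<^sub>v ?l i = ?e i" for i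
    using e[of i] K0(1) by (auto simp: vec_eq_iff)
  define Cond where "Cond \<longleftrightarrow> (\<forall>i \<in> {1..pbar}. d i \<ge> 0) \<and>
    (\<forall>i \<in> {1..pbar} - {1..p}. ?e i - ?K\<^sub>0\<^sup>T *\<^sub>v ?l i = 0\<^sub>v n)"

  have safe_iff: "safe_stabilizing_gain A B c d r \<alpha> pbar K \<longleftrightarrow>
      Cond \<and> (K \<in> carrier_mat m n \<and> (\<exists>K' \<in> carrier_mat (m - p) n. K = ?K\<^sub>0 + L_perp * K') \<and>
      hurwitz (A - B * K))" for K
  proof (cases "K \<in> carrier_mat m n")
    case K: True
    have "(\<forall>x \<in> carrier_vec n. hocbf_constraint A B c d r \<alpha> i x (- (K *\<^sub>v x))) \<longleftrightarrow>
        K\<^sup>T *\<^sub>v ?l i = ?e i \<and> d i \<ge> 0" if i: "i \<in> {1..pbar}" for i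
      using \<alpha>[OF i] by (intro hocbf_constraint_all_states_iff[where c = c and i = i and r = r and \<alpha> = \<alpha>, OF A B c[OF i] K] prod_pos) auto
    moreover have "globally_exp_stable (A - B * K) \<longleftrightarrow> hurwitz (A - B * K)"
      by (rule globally_exp_stable_iff_hurwitz[OF minus_carrier_mat[OF mult_carrier_mat[OF B K]]])
    ultimately have "safe_stabilizing_gain A B c d r \<alpha> pbar K \<longleftrightarrow>
        (\<forall>i \<in> {1..pbar}. K\<^sup>T *\<^sub>v ?l i = ?e i \<and> d i \<ge> 0) \<and> hurwitz (A - B * K)"
      using A B K by (simp add: safe_stabilizing_gain_def)
    moreover have "(\<forall>i \<in> {1..pbar}. K\<^sup>T *\<^sub>v ?l i = ?e i \<and> d i \<ge> 0) \<longleftrightarrow>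
        Cond \<and> (\<forall>i \<in> {1..p}. K\<^sup>T *\<^sub>v ?l i = ?e i)"
    proof -
      have "{1..pbar} = {1..p} \<union> ({1..pbar} - {1..p})" using p by auto
      then have "(\<forall>i \<in> {1..pbar}. K\<^sup>T *\<^sub>v ?l i = ?e i) \<longleftrightarrow>
          (\<forall>i \<in> {1..p}. K\<^sup>T *\<^sub>v ?l i = ?e i) \<and> (\<forall>i \<in> {1..pbar} - {1..p}. K\<^sup>T *\<^sub>v ?l i = ?e i)"
        by blast
      then show ?thesis
        unfolding Cond_def redundancy using dependent[OF K] by auto
    qed
    ultimately show ?thesis using param[OF K] K by blast
  next
    case False
    then show ?thesis using A B by (auto simp: safe_stabilizing_gain_def)
  qed

  define M where "M = A - B * ?K\<^sub>0"
  have M: "M \<in> carrier_mat n n"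
    unfolding M_def by (rule minus_carrier_mat[OF mult_carrier_mat[OF B K0(1)]])
  have G: "B * L_perp \<in> carrier_mat n (m - p)" by (rule mult_carrier_mat[OF B Lp(1)])
  have loop: "M - B * L_perp * H = A - B * (?K\<^sub>0 + L_perp * H)" if "H \<in> carrier_mat (m - p) n" for H
    unfolding M_def by (rule closed_loop_split[OF A B K0(1) Lp(1) that, symmetric])

  have exists_iff: "(\<exists>K. safe_stabilizing_gain A B c d r \<alpha> pbar K) \<longleftrightarrow> Cond \<and> stabilizable M (B * L_perp)"
  proof -
    have "stabilizable M (B * L_perp) \<longleftrightarrow>
        (\<exists>H \<in> carrier_mat (m - p) n. hurwitz (A - B * (?K\<^sub>0 + L_perp * H)))"
      unfolding stabilizable_def carrier_matD(1)[OF M] carrier_matD(2)[OF G]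
      by (intro bex_cong refl) (simp only: loop)
    moreover have "?K\<^sub>0 + L_perp * H \<in> carrier_mat m n" if "H \<in> carrier_mat (m - p) n" for H
      using K0(1) mult_carrier_mat[OF Lp(1) that] by simp
    ultimately show ?thesis unfolding safe_iff by blast
  qed

  \<comment> \<open>Every gain \<open>K\<^sub>0 + L_perp H\<close> meets the first \<open>p\<close> gain conditions, so all these closed loops drive the
    same cascades.\<close>
  have psi_vec_loop: "(M - B * L_perp * H)\<^sup>T *\<^sub>v ?f i j =
      (if Suc j < r i then ?f i (Suc j) else 0\<^sub>v n) - \<alpha> i (Suc j) \<cdot>\<^sub>v ?f i j"
    if H: "H \<in> carrier_mat (m - p) n" and i: "i \<in> {1..p}" and j: "j < r i" for H i j
  proof -
    have K: "?K\<^sub>0 + L_perp * H \<in> carrier_mat m n" using K0(1) mult_carrier_mat[OF Lp(1) H] by simp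
    have "(?K\<^sub>0 + L_perp * H)\<^sup>T *\<^sub>v ?l i = ?e i" using param[OF K] H i by blast
    moreover have "i \<in> {1..pbar}" using i p by simp
    ultimately show ?thesis
      unfolding loop[OF H] using psi_vec_closed_loop[where c = c and i = i and r = r and \<alpha> = \<alpha>, OF A B c deg j K] by blast
  qed
  have W: "?W = {x \<in> carrier_vec n. \<forall>i \<in> {1..p}. \<forall>j < r i. ?f i j \<bullet> x = 0}"
    by (rule mat_kernel_T_psi[OF A])
  have loop_carrier: "M - B * L_perp * H \<in> carrier_mat n n" if "H \<in> carrier_mat (m - p) n" for H
    by (rule minus_carrier_mat[OF mult_carrier_mat[OF G that]])
  \<comment> \<open>The transposed closed loop maps each functional of a cascade to a combination of functionals of the
    same cascade, so their joint kernel \<open>W\<close> is invariant.\<close>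
  have invariant: "(M - B * L_perp * H) *\<^sub>v x \<in> ?W" if H: "H \<in> carrier_mat (m - p) n" and x: "x \<in> ?W" for H x
  proof -
    let ?N = "M - B * L_perp * H"
    have xn: "x \<in> carrier_vec n" and zero: "\<And>i j. i \<in> {1..p} \<Longrightarrow> j < r i \<Longrightarrow> ?f i j \<bullet> x = 0"
      using x unfolding W by auto
    have f: "?f i j \<in> carrier_vec n" for i j by (rule psi_vec_carrier[OF A])
    have "?f i j \<bullet> (?N *\<^sub>v x) = 0" if i: "i \<in> {1..p}" and j: "j < r i" for i j
    proof -
      have "?f i j \<bullet> (?N *\<^sub>v x) = (?N\<^sup>T *\<^sub>v ?f i j) \<bullet> x"
        by (rule transpose_vec_mult_scalar[OF loop_carrier[OF H] xn f, symmetric])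
      also have "\<dots> = (if Suc j < r i then ?f i (Suc j) else 0\<^sub>v n) \<bullet> x - (\<alpha> i (Suc j) \<cdot>\<^sub>v ?f i j) \<bullet> x"
        unfolding psi_vec_loop[OF H i j]
        using f xn by (intro minus_scalar_prod_distrib[of _ n]) (auto simp del: Phi.simps)
      also have "\<dots> = 0"
        using zero[OF i j] zero[OF i, of "Suc j"] xn smult_scalar_prod_distrib[OF f xn]
        by (simp del: Phi.simps)
      finally show ?thesis .
    qed
    then show ?thesis
      unfolding W using mult_mat_vec_carrier[OF loop_carrier[OF H] xn] by blast
  qed
  have transverse: "x \<in> ?W \<and> y \<in> ?W"
    if H: "H \<in> carrier_mat (m - p) n" and E: "real_eigenpair (M - B * L_perp * H) a b x y" and a: "a \<ge> 0"
    for H a b x y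
  proof -
    have xy: "x \<in> carrier_vec n" "y \<in> carrier_vec n"
      using E loop_carrier[OF H] by (auto simp: real_eigenpair_def)
    have "?f i j \<bullet> x = 0 \<and> ?f i j \<bullet> y = 0" if i: "i \<in> {1..p}" and j: "j < r i" for i j
    proof (rule real_eigenpair_annihilates_decaying_chain[OF loop_carrier[OF H] psi_vec_carrier[OF A] _ _ E a j])
      show "(M - B * L_perp * H)\<^sup>T *\<^sub>v ?f i j =
          (if Suc j < r i then ?f i (Suc j) else 0\<^sub>v n) - \<alpha> i (Suc j) \<cdot>\<^sub>v ?f i j" if "j < r i" for j
        by (rule psi_vec_loop[OF H i that])
      show "\<alpha> i j > 0" if "j \<in> {1..r i}" for j using \<alpha>[OF _ that] i p by simp
    qed
    with xy show ?thesis unfolding W by blast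
  qed
  have stab_iff: "stabilizable (T\<^sub>\<eta>\<^sup>T * M * T\<^sub>\<eta> * inv_mat (T\<^sub>\<eta>\<^sup>T * T\<^sub>\<eta>)) (T\<^sub>\<eta>\<^sup>T * (B * L_perp)) \<longleftrightarrow>
      stabilizable M (B * L_perp)"
    by (rule stabilizable_iff_restriction[OF M G T(1), unfolded T(2)])
      (assumption | rule T(3) invariant transverse)+
  have Gamma: "Gamma_eta A B c r \<alpha> p T\<^sub>\<eta> = T\<^sub>\<eta>\<^sup>T * M * T\<^sub>\<eta> * inv_mat (T\<^sub>\<eta>\<^sup>T * T\<^sub>\<eta>)"
  proof -
    let ?J = "inv_mat (?L\<^sup>T * ?L)" and ?C = "C_tilde A c r \<alpha> p"
    have Tt: "T\<^sub>\<eta>\<^sup>T \<in> carrier_mat ?k n" using T(1) by simp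
    have J: "?J \<in> carrier_mat p p" by (rule inv_mat_gram(1)[OF L L_mat_injective[OF B indpt]])
    have C: "?C \<in> carrier_mat p n" by (rule C_tilde_carrier[OF A])
    have "T\<^sub>\<eta>\<^sup>T * B * ?L * ?J * ?C = T\<^sub>\<eta>\<^sup>T * (B * ?K\<^sub>0)"
      unfolding K_zero_def
      by (simp only: assoc_mult_mat[OF Tt B L] assoc_mult_mat[OF Tt mult_carrier_mat[OF B L] J]
          assoc_mult_mat[OF B L J] assoc_mult_mat[OF B mult_carrier_mat[OF L J] C]
          assoc_mult_mat[OF Tt mult_carrier_mat[OF B mult_carrier_mat[OF L J]] C])
    then have "A_hat A B c r \<alpha> p T\<^sub>\<eta> = T\<^sub>\<eta>\<^sup>T * M"
      unfolding A_hat_def M_def mult_minus_distrib_mat[OF Tt A mult_carrier_mat[OF B K0(1)]] by simp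
    then show ?thesis by (simp only: Gamma_eta_def)
  qed
  have G_eta: "T\<^sub>\<eta>\<^sup>T * B * L_perp = T\<^sub>\<eta>\<^sup>T * (B * L_perp)"
    using T(1) by (intro assoc_mult_mat[OF _ B Lp(1)]) simp
  show ?thesis
    using exists_iff stab_iff safe_iff
    unfolding Gamma G_eta M_def[symmetric] Cond_def by blast
qed

end
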